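(* Let $n\le p$ and let $k\ge1$ be an integer with $4k\le n$. Assume that the linear map $\mathscr{S}:M_{n\times p}\to\mathbb{C}^m$ has restricted isometry constant $\delta_{4k}<\sqrt2-1$. Then $\mathscr{S}$ satisfies the strong rank null space property of order $k$ with constant $$\eta=\sqrt2\,\frac{\delta_{4k}}{1-\delta_{3k}}\in(0,1).$$
   Context: $M_{n\times p}$ is the space of complex $n\times p$ matrices with inner product $\langle X,Y\rangle=\operatorname{Tr}(XY^* )$ and Frobenius norm $\|\cdot\|_F$; $\|X\|_*$ is the nuclear norm (sum of singular values). Restricted isometry constants: for a linear map $\mathscr{S}:M_{n\times p}\to\mathbb{C}^m$ and an integer $1\le k\le n$, $\delta_k=\delta_k(\mathscr{S})>0$ is the smallest number such that $(1-\delta_k)\|X\|_F^2\le\|\mathscr{S}(X)\|_{\ell_2^m}^2\le(1+\delta_k)\|X\|_F^2$ for all $X\in M_{n\times p}$ of rank at most $k$. (By definition it is taken to be positive.) Strong rank null space property (SRNSP) of order $k$ with constant $\eta\in(0,1)$: for all $X\in\ker\mathscr{S}\setminus\{0\}$ and all decompositions $X=X_1+X_2$ with $\operatorname{rank}(X_1)\le k$, there exists another decomposition $X=H_1+H_2$ such that $\operatorname{rank}(H_1)\le 2k$, $\langle H_1,H_2\rangle=0$, $X_1H_2^*=0$, $X_1^*H_2=0$, and $\|H_1\|_*\le\eta\|H_2\|_*$. *)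

theory Defs
  imports
    "Jordan_Normal_Form.Schur_Decomposition"
    "Jordan_Normal_Form.DL_Rank"
begin

definition mat_inner :: "complex mat \<Rightarrow> complex mat \<Rightarrow> complex" where
  "mat_inner X Y = (\<Sum>i<dim_row X. (X * mat_adjoint Y) $$ (i, i))"

definition frob_norm :: "complex mat \<Rightarrow> real" where
  "frob_norm X = sqrt (Re (mat_inner X X))"

definition l2_norm :: "complex vec \<Rightarrow> real" where
  "l2_norm v = sqrt (\<Sum>i<dim_vec v. (cmod (v $ i))\<^sup>2)"

(* Square roots of the eigenvalues of X X*, with algebraic multiplicity. For an n x p matrix
   with n > p this multiset contains n - p additional zeros, which do not affect nuclear_norm. *)
definition singular_values :: "complex mat \<Rightarrow> real multiset" where
  "singular_values X =
     image_mset (\<lambda>z. sqrt (Re z)) (proots (char_poly (X * mat_adjoint X)))"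

definition nuclear_norm :: "complex mat \<Rightarrow> real" where
  "nuclear_norm X = sum_mset (singular_values X)"

abbreviation mat_vec_linear :: "nat \<Rightarrow> nat \<Rightarrow> nat \<Rightarrow> (complex mat \<Rightarrow> complex vec) \<Rightarrow> bool" where
  "mat_vec_linear n p m \<S> \<equiv>
     linear_map class_ring (module_mat TYPE(complex) n p) (module_vec TYPE(complex) m) \<S>"

definition rip_bounds ::
    "nat \<Rightarrow> nat \<Rightarrow> (complex mat \<Rightarrow> complex vec) \<Rightarrow> nat \<Rightarrow> real \<Rightarrow> bool" where
  "rip_bounds n p \<S> k \<delta> \<longleftrightarrow>
     (\<forall>X\<in>carrier_mat n p. vec_space.rank n X \<le> k \<longrightarrow>
        (1 - \<delta>) * (frob_norm X)\<^sup>2 \<le> (l2_norm (\<S> X))\<^sup>2 \<and>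
        (l2_norm (\<S> X))\<^sup>2 \<le> (1 + \<delta>) * (frob_norm X)\<^sup>2)"

(* For linear \<S> and n, p, k >= 1 the least such number exists and is nonnegative. It is 0 exactly
   when \<S> is isometric on the matrices of rank at most k; the convention that restricted isometry
   constants are positive excludes this case and has to be required where the constant is used.
   For k >= 2, isometry on rank at most k forces isometry on all matrices (polarization), so
   positivity at one such order is equivalent to positivity at any other. *)
definition rip_const :: "nat \<Rightarrow> nat \<Rightarrow> (complex mat \<Rightarrow> complex vec) \<Rightarrow> nat \<Rightarrow> real" where
  "rip_const n p \<S> k = (LEAST \<delta>. rip_bounds n p \<S> k \<delta>)"

definition strong_rank_nsp ::
    "nat \<Rightarrow> nat \<Rightarrow> nat \<Rightarrow> (complex mat \<Rightarrow> complex vec) \<Rightarrow> nat \<Rightarrow> real \<Rightarrow> bool" where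
  "strong_rank_nsp n p m \<S> k \<eta> \<longleftrightarrow>
     0 < \<eta> \<and> \<eta> < 1 \<and>
     (\<forall>X\<in>carrier_mat n p. \<forall>X\<^sub>1\<in>carrier_mat n p. \<forall>X\<^sub>2\<in>carrier_mat n p.
        \<S> X = 0\<^sub>v m \<and> X \<noteq> 0\<^sub>m n p \<and> X = X\<^sub>1 + X\<^sub>2 \<and> vec_space.rank n X\<^sub>1 \<le> k \<longrightarrow>
        (\<exists>H\<^sub>1\<in>carrier_mat n p. \<exists>H\<^sub>2\<in>carrier_mat n p.
           X = H\<^sub>1 + H\<^sub>2 \<and>
           vec_space.rank n H\<^sub>1 \<le> 2 * k \<and>
           mat_inner H\<^sub>1 H\<^sub>2 = 0 \<and>
           X\<^sub>1 * mat_adjoint H\<^sub>2 = 0\<^sub>m n n \<and>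
           mat_adjoint X\<^sub>1 * H\<^sub>2 = 0\<^sub>m p p \<and>
           nuclear_norm H\<^sub>1 \<le> \<eta> * nuclear_norm H\<^sub>2))"

end

theory Submission
  imports Defs
begin

text \<open>
  Let \<open>P\<close> and \<open>Q\<close> be the projections onto the column and row space of \<open>X\<^sub>1\<close>, and put
  \<open>H\<^sub>2 = (1 - P) X (1 - Q)\<close>, \<open>H\<^sub>1 = X - H\<^sub>2\<close>. Split the singular value decomposition of \<open>H\<^sub>2\<close> into
  consecutive blocks \<open>B\<^sub>0, B\<^sub>1, \<dots>\<close> of \<open>k\<close> decreasing singular values, and let \<open>Y = H\<^sub>1 + B\<^sub>0\<close>, of rank at
  most \<open>3k\<close>. Since \<open>X\<close> lies in the kernel, \<open>S Y\<close> is minus the sum of the \<open>S B\<^sub>j\<close> with \<open>j \<ge> 1\<close>;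
  as \<open>Y\<close> and \<open>B\<^sub>j\<close> are orthogonal of total rank at most \<open>4k\<close>, expanding the square of the norm of
  \<open>S Y\<close> gives \<open>(1 - \<delta>\<^bsub>3k\<^esub>) \<parallel>Y\<parallel> \<le> \<delta>\<^bsub>4k\<^esub> (\<Sum>j\<ge>1. \<parallel>B\<^sub>j\<parallel>)\<close> in Frobenius norm. Every singular value in
  \<open>B\<^sub>j\<close> is at most the average of those in the preceding block, so the sum on the right is at most
  the nuclear norm of \<open>H\<^sub>2\<close> divided by \<open>sqrt k\<close>, while that of \<open>H\<^sub>1\<close> is at most \<open>sqrt (2k) \<parallel>Y\<parallel>\<close>.

  Only left singular vectors are used: the piece of \<open>A\<close> belonging to a set \<open>T\<close> of singular values
  is \<open>U D\<^sub>T U\<^sup>* A\<close>, where \<open>U\<close> diagonalizes \<open>A A\<^sup>*\<close> and \<open>D\<^sub>T\<close> is the diagonal indicator matrix of \<open>T\<close>.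
\<close>

subsection \<open>Unitary diagonalization of Hermitian matrices\<close>

lemma mat_adjoint_dim [simp]:
  "dim_row (mat_adjoint A) = dim_col A" "dim_col (mat_adjoint A) = dim_row A"
  by (simp_all add: mat_adjoint_def)

lemma mat_adjoint_carrier [simp]:
  "mat_adjoint A \<in> carrier_mat p n \<longleftrightarrow> A \<in> carrier_mat n p"
  by (auto intro!: carrier_matI dest: carrier_matD)

lemma mat_adjoint_index [simp]:
  fixes A :: "complex mat"
  shows "i < dim_col A \<Longrightarrow> j < dim_row A \<Longrightarrow> mat_adjoint A $$ (i, j) = cnj (A $$ (j, i))"
  unfolding mat_adjoint_def by (subst mat_of_rows_index) auto

lemma mat_adjoint_adjoint [simp]: "mat_adjoint (mat_adjoint A) = (A :: complex mat)"
  by (rule eq_matI) auto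

lemma mat_adjoint_mult:
  fixes A B :: "complex mat"
  assumes "A \<in> carrier_mat n p" "B \<in> carrier_mat p q"
  shows "mat_adjoint (A * B) = mat_adjoint B * mat_adjoint A"
proof (rule eq_matI)
  fix i j assume "i < dim_row (mat_adjoint B * mat_adjoint A)" "j < dim_col (mat_adjoint B * mat_adjoint A)"
  then have "i < q" "j < n" using assms by auto
  then show "mat_adjoint (A * B) $$ (i, j) = (mat_adjoint B * mat_adjoint A) $$ (i, j)"
    using assms by (auto simp: scalar_prod_def mult.commute intro!: sum.cong)
qed (use assms in auto)

lemma mat_adjoint_minus:
  fixes A B :: "complex mat"
  assumes "A \<in> carrier_mat n p" "B \<in> carrier_mat n p"
  shows "mat_adjoint (A - B) = mat_adjoint A - mat_adjoint B"
  using assms by (intro eq_matI) auto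

lemma mat_adjoint_one [simp]: "mat_adjoint (1\<^sub>m n) = (1\<^sub>m n :: complex mat)"
  by (rule eq_matI) auto

lemma mat_mult_index_sum:
  assumes "A \<in> carrier_mat n p" "B \<in> carrier_mat p q" "i < n" "j < q"
  shows "(A * B) $$ (i, j) = (\<Sum>l<p. A $$ (i, l) * B $$ (l, j))"
  using assms by (auto simp: scalar_prod_def atLeast0LessThan)

text \<open>Gram-Schmidt applied to a completion of \<open>v\<close> to a basis keeps the head of
  the list, so normalizing the resulting orthogonal vectors only rescales \<open>v\<close> in the
  first column.\<close>

lemma unitary_with_first_col:
  fixes v :: "complex vec"
  assumes v: "v \<in> carrier_vec n" "v \<noteq> 0\<^sub>v n"
  obtains W c where "W \<in> carrier_mat n n" "mat_adjoint W * W = 1\<^sub>m n" "col W 0 = c \<cdot>\<^sub>v v"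
proof -
  interpret cof_vec_space n "TYPE(complex)" .
  have n: "n \<noteq> 0" using v by auto
  define b where "b = basis_completion v"
  define ws where "ws = gram_schmidt n b"
  note bc = basis_completion[OF v, folded b_def]
  from bc(6,7) n obtain vs where bv: "b = v # vs" by (cases b) auto
  note gs = gram_schmidt_result[OF bc(2,4,5) ws_def]
  have hdws: "hd ws = v" unfolding ws_def bv by (rule gram_schmidt_hd[OF v(1)])
  have len: "length ws = n" using gs(4) bc(6) by simp
  have wsc: "ws ! i \<in> carrier_vec n" if "i < n" for i using gs(3) len that by auto
  \<comment> \<open>This is the Euclidean norm of \<open>ws ! i\<close> as a complex number: the
    inner product under \<open>csqrt\<close> is real and nonnegative, which is what
    \<open>sq\<close> rests on.\<close>
  define s where "s i = csqrt (ws ! i \<bullet>c ws ! i)" for i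
  have nz: "ws ! i \<bullet>c ws ! i \<noteq> 0" if "i < n" for i
    using corthogonalD[OF gs(2)] len that by auto
  have sq: "cnj (s i) * s i = ws ! i \<bullet>c ws ! i" for i
  proof -
    have "ws ! i \<bullet>c ws ! i \<ge> 0" by (rule conjugate_square_ge_0_vec)
    then have "Im (ws ! i \<bullet>c ws ! i) = 0" "Re (ws ! i \<bullet>c ws ! i) \<ge> 0"
      by (auto simp: less_eq_complex_def)
    then have "s i = complex_of_real (sqrt (Re (ws ! i \<bullet>c ws ! i)))"
      unfolding s_def by (simp add: csqrt.ctr complex_eq_iff cmod_def)
    with \<open>Im _ = 0\<close> \<open>Re _ \<ge> 0\<close> show ?thesis
      by (simp add: complex_eq_iff)
  qed
  define W where "W = mat n n (\<lambda>(a, i). ws ! i $ a / s i)"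
  have W: "W \<in> carrier_mat n n" by (simp add: W_def)
  have "mat_adjoint W * W = 1\<^sub>m n"
  proof (rule eq_matI)
    fix i j assume "i < dim_row (1\<^sub>m n :: complex mat)" "j < dim_col (1\<^sub>m n :: complex mat)"
    then have i: "i < n" and j: "j < n" by auto
    have "(mat_adjoint W * W) $$ (i, j) = (\<Sum>a<n. cnj (ws ! i $ a / s i) * (ws ! j $ a / s j))"
      using i j by (subst mat_mult_index_sum[of _ n n _ n]) (auto simp: W_def)
    also have "\<dots> = (ws ! j \<bullet>c ws ! i) / (cnj (s i) * s j)"
      using wsc[OF i] wsc[OF j]
      by (auto simp: scalar_prod_def sum_divide_distrib atLeast0LessThan mult.commute intro!: sum.cong)
    also have "\<dots> = (1\<^sub>m n :: complex mat) $$ (i, j)"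
      using corthogonalD[OF gs(2), of j i] i j len sq[of i] nz[OF i] by auto
    finally show "(mat_adjoint W * W) $$ (i, j) = (1\<^sub>m n :: complex mat) $$ (i, j)" .
  qed (use W in auto)
  moreover have "col W 0 = (1 / s 0) \<cdot>\<^sub>v v"
  proof -
    have "ws ! 0 = v" using hdws len n by (metis hd_conv_nth length_0_conv)
    then show ?thesis using n v by (intro eq_vecI) (auto simp: W_def)
  qed
  ultimately show ?thesis using that W by blast
qed

lemma unitary_mult_adjoint:
  fixes U :: "complex mat"
  assumes "U \<in> carrier_mat n n" "mat_adjoint U * U = 1\<^sub>m n"
  shows "U * mat_adjoint U = 1\<^sub>m n"
  using mat_mult_left_right_inverse[of "mat_adjoint U" n U] assms by auto

text \<open>Deflation: a unitary matrix whose first column is an eigenvector for the head of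
  \<open>es\<close> splits that eigenvalue off, and the induction hypothesis diagonalizes the
  remaining block. The diagonal follows the order of \<open>es\<close>, so a caller can ask for
  sorted eigenvalues.\<close>

lemma hermitian_diagonalization:
  fixes A :: "complex mat"
  assumes "A \<in> carrier_mat n n" "mat_adjoint A = A" "char_poly A = (\<Prod>e\<leftarrow>es. [:- e, 1:])"
  shows "\<exists>U\<in>carrier_mat n n. mat_adjoint U * U = 1\<^sub>m n \<and>
    mat_adjoint U * A * U = mat n n (\<lambda>(i, j). if i = j then es ! i else 0)"
  using assms
proof (induction es arbitrary: n A)
  case Nil
  then have "n = 0" using degree_monic_char_poly[of A n] by simp
  then show ?case using Nil.prems by (intro bexI[of _ "1\<^sub>m 0"]) (auto intro!: eq_matI)
next
  case (Cons e es n A)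
  note A = \<open>A \<in> carrier_mat n n\<close>
  have cp: "char_poly A = [:- e, 1:] * (\<Prod>e\<leftarrow>es. [:- e, 1:])" using Cons.prems by simp
  have "monic (\<Prod>e\<leftarrow>es. [:- e, 1:])" by (rule monic_prod_list) auto
  then have "degree (char_poly A) = Suc (degree (\<Prod>e\<leftarrow>es. [:- e, 1:]))"
    unfolding cp by (subst degree_mult_eq) auto
  with degree_monic_char_poly[OF A] obtain n1 where n: "n = Suc n1" by (cases n) auto
  have "eigenvalue A e" unfolding eigenvalue_root_char_poly[OF A] cp by simp
  then obtain v where v: "v \<in> carrier_vec n" "v \<noteq> 0\<^sub>v n" "A *\<^sub>v v = e \<cdot>\<^sub>v v"
    using A by (auto simp: eigenvalue_def eigenvector_def)
  obtain W c where W: "W \<in> carrier_mat n n" "mat_adjoint W * W = 1\<^sub>m n" "col W 0 = c \<cdot>\<^sub>v v"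
    using unitary_with_first_col[OF v(1,2)] by blast
  note WW = unitary_mult_adjoint[OF W(1,2)]
  define A' where "A' = mat_adjoint W * A * W"
  have A': "A' \<in> carrier_mat n n" using W A by (auto simp: A'_def)
  have A'_adj: "mat_adjoint A' = A'"
    using W(1) A Cons.prems(2) unfolding A'_def
    by (simp add: mat_adjoint_mult[of _ n n _ n] assoc_mult_mat[of _ n n _ n _ n])
  have col0: "A' $$ (i, 0) = (if i = 0 then e else 0)" if "i < n" for i
  proof -
    have *: "mat_adjoint W \<in> carrier_mat n n" "A * W \<in> carrier_mat n n" "0 < n" "col W 0 \<in> carrier_vec n"
      using W(1) A n col_carrier_vec[of 0 n W n] by auto
    have "col A' 0 = mat_adjoint W *\<^sub>v (A *\<^sub>v col W 0)"
      unfolding A'_def assoc_mult_mat[OF *(1) A W(1)] col_mult2[OF *(1-3)] col_mult2[OF A W(1) *(3)] ..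
    also have "A *\<^sub>v col W 0 = e \<cdot>\<^sub>v col W 0"
      unfolding W(3) mult_mat_vec[OF A v(1)] v(3) by (simp add: smult_smult_assoc mult.commute)
    also have "mat_adjoint W *\<^sub>v (e \<cdot>\<^sub>v col W 0) = e \<cdot>\<^sub>v col (mat_adjoint W * W) 0"
      unfolding mult_mat_vec[OF *(1,4)] col_mult2[OF *(1) W(1) *(3)] ..
    finally have "col A' 0 = e \<cdot>\<^sub>v col (1\<^sub>m n) 0" using W(2) by simp
    then have "col A' 0 $ i = (e \<cdot>\<^sub>v col (1\<^sub>m n) 0) $ i" by simp
    then show ?thesis using that n A' by (auto simp: col_def)
  qed
  \<comment> \<open>Here Hermitian symmetry enters: it turns the zeros of the first column into
    zeros of the first row, so \<open>A'\<close> is block diagonal and not merely block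
    triangular.\<close>
  have row0: "A' $$ (0, i) = (if i = 0 then e else 0)" if "i < n" for i
  proof (cases "i = 0")
    case False
    have "A' $$ (0, i) = cnj (A' $$ (i, 0))"
      using that n A' by (subst A'_adj[symmetric]) auto
    then show ?thesis using col0[OF that] False by simp
  qed (use col0[OF that] in auto)
  define A3 where "A3 = mat n1 n1 (\<lambda>(i, j). A' $$ (Suc i, Suc j))"
  define E where "E = mat 1 1 (\<lambda>_. e)"
  have A3: "A3 \<in> carrier_mat n1 n1" and E: "E \<in> carrier_mat 1 1" by (auto simp: A3_def E_def)
  have blk: "A' = four_block_mat E (0\<^sub>m 1 n1) (0\<^sub>m n1 1) A3"
  proof (rule eq_matI)
    fix i j assume "i < dim_row (four_block_mat E (0\<^sub>m 1 n1) (0\<^sub>m n1 1) A3)"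
      "j < dim_col (four_block_mat E (0\<^sub>m 1 n1) (0\<^sub>m n1 1) A3)"
    then have "i < n" "j < n" by (auto simp: n A3_def E_def)
    then show "A' $$ (i, j) = four_block_mat E (0\<^sub>m 1 n1) (0\<^sub>m n1 1) A3 $$ (i, j)"
      using col0[of i] row0[of j] by (cases i; cases j) (simp_all add: n A3_def E_def)
  qed (use A' n in \<open>auto simp: A3_def E_def\<close>)
  have A3_adj: "mat_adjoint A3 = A3"
  proof (rule eq_matI)
    fix i j assume "i < dim_row A3" "j < dim_col A3"
    then have "i < n1" "j < n1" by (auto simp: A3_def)
    then show "mat_adjoint A3 $$ (i, j) = A3 $$ (i, j)"
      using mat_adjoint_index[of "Suc i" A' "Suc j"] A' n unfolding A'_adj by (simp add: A3_def)
  qed (auto simp: A3_def)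
  \<comment> \<open>Similarity preserves the characteristic polynomial. Cancelling the factor of
    \<open>e\<close> leaves that of \<open>A3\<close>, in the form that the induction hypothesis
    demands.\<close>
  have "similar_mat A' A"
    by (rule similar_matI[of _ _ "mat_adjoint W" W n]) (use W WW A A' in \<open>auto simp: A'_def\<close>)
  then have "[:- e, 1:] * (\<Prod>e\<leftarrow>es. [:- e, 1:]) = char_poly A'"
    using char_poly_similar cp by metis
  also have "\<dots> = char_poly E * char_poly A3"
    unfolding blk by (rule char_poly_four_block_zeros_col) (use E A3 in auto)
  also have "char_poly E = [:- e, 1:]"
    by (simp add: E_def char_poly_defs det_def sign_def)
  finally have "char_poly A3 = (\<Prod>e\<leftarrow>es. [:- e, 1:])"
    by (metis mult_cancel_left pCons_eq_0_iff zero_neq_one)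
  from Cons.IH[OF A3 A3_adj this] obtain V where V: "V \<in> carrier_mat n1 n1" "mat_adjoint V * V = 1\<^sub>m n1"
    "mat_adjoint V * A3 * V = mat n1 n1 (\<lambda>(i, j). if i = j then es ! i else 0)" by blast
  define F where "F = four_block_mat (1\<^sub>m 1) (0\<^sub>m 1 n1) (0\<^sub>m n1 1) V"
  have F: "F \<in> carrier_mat n n" using V n by (auto simp: F_def)
  have Fadj: "mat_adjoint F = four_block_mat (1\<^sub>m 1) (0\<^sub>m 1 n1) (0\<^sub>m n1 1) (mat_adjoint V)"
    by (rule eq_matI) (use V in \<open>auto simp: F_def\<close>)
  have FF: "mat_adjoint F * F = 1\<^sub>m n"
    unfolding Fadj unfolding F_def
    by (subst mult_four_block_mat[of _ 1 1 _ n1 _ n1 _ _ 1 _ n1]) (use V n in auto)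
  have FAF: "mat_adjoint F * A' * F = four_block_mat E (0\<^sub>m 1 n1) (0\<^sub>m n1 1) (mat_adjoint V * A3 * V)"
    unfolding Fadj blk unfolding F_def
    using V A3 E
    by (simp add: mult_four_block_mat[of _ 1 1 _ n1 _ n1 _ _ 1 _ n1])
  define U where "U = W * F"
  have U: "U \<in> carrier_mat n n" using W F by (simp add: U_def)
  have Uadj: "mat_adjoint U = mat_adjoint F * mat_adjoint W"
    unfolding U_def by (rule mat_adjoint_mult[OF W(1) F])
  have "mat_adjoint U * U = mat_adjoint F * ((mat_adjoint W * W) * F)"
    unfolding Uadj unfolding U_def using W(1) F by (simp add: assoc_mult_mat[of _ n n _ n _ n])
  then have "mat_adjoint U * U = 1\<^sub>m n" using W F FF by simp
  moreover have "mat_adjoint U * A * U = mat_adjoint F * A' * F"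
    unfolding Uadj unfolding U_def A'_def using W(1) F A by (simp add: assoc_mult_mat[of _ n n _ n _ n])
  moreover have "\<dots> = mat n n (\<lambda>(i, j). if i = j then (e # es) ! i else 0)"
    unfolding FAF V(3) by (rule eq_matI) (auto simp: n E_def)
  ultimately show ?case using U by auto
qed

subsection \<open>Rank factorization\<close>

text \<open>Each index in \<open>T\<close> contributes a matrix of rank at most one, and rank is
  subadditive.\<close>

lemma rank_le_cardI:
  fixes A :: "complex mat"
  assumes "finite T" "A \<in> carrier_mat n p"
    "\<And>i j. i < n \<Longrightarrow> j < p \<Longrightarrow> A $$ (i, j) = (\<Sum>a\<in>T. f i a * g a j)"
  shows "vec_space.rank n A \<le> card T"
  using assms
proof (induction T arbitrary: A rule: finite_induct)
  case empty
  then have "A = 0\<^sub>m n p" by (intro eq_matI) auto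
  then show ?case by (simp add: vec_space.rank_0I)
next
  case (insert t T A)
  define A1 where "A1 = mat n p (\<lambda>(i, j). f i t * g t j)"
  define A2 where "A2 = mat n p (\<lambda>(i, j). \<Sum>a\<in>T. f i a * g a j)"
  have c: "A1 \<in> carrier_mat n p" "A2 \<in> carrier_mat n p" by (auto simp: A1_def A2_def)
  have "A = A1 + A2"
    using insert by (intro eq_matI) (auto simp: A1_def A2_def)
  then have "vec_space.rank n A \<le> vec_space.rank n A1 + vec_space.rank n A2"
    using vec_space.rank_subadditive[OF c] by simp
  also have "vec_space.rank n A1 \<le> 1"
    by (rule vec_space.rank_le_1_product_entries[OF c(1), of "\<lambda>i. f i t" "g t"]) (auto simp: A1_def)
  also have "vec_space.rank n A2 \<le> card T"
    by (rule insert.IH[OF c(2)]) (auto simp: A2_def)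
  finally show ?case using insert by simp
qed

text \<open>A maximal independent set \<open>S\<close> of columns spans all columns. The entries of
  its members form the left factor, the coefficients of the columns the right one. Together with
  \<open>rank_le_cardI\<close> this reduces rank bounds to manipulations of sums.\<close>

lemma rank_factorization:
  fixes A :: "complex mat"
  assumes A: "A \<in> carrier_mat n p" and r: "vec_space.rank n A \<le> r"
  obtains f g where "\<And>i j. i < n \<Longrightarrow> j < p \<Longrightarrow> A $$ (i, j) = (\<Sum>a<r. f i a * g a j)"
proof -
  interpret vec_space "TYPE(complex)" n .
  have colsc: "set (cols A) \<subseteq> carrier_vec n" using A cols_dim by blast
  obtain S where S: "maximal S (\<lambda>T. T \<subseteq> set (cols A) \<and> lin_indpt T)" "finite S"
    using maximal_exists_superset[of "set (cols A)" "\<lambda>T. T \<subseteq> set (cols A) \<and> lin_indpt T" "{}"]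
    by (auto simp: lin_dep_def)
  then have Sc: "S \<subseteq> set (cols A)" "lin_indpt S" by (auto simp: maximal_def)
  have Sv: "S \<subseteq> carrier_vec n" using Sc colsc by blast
  have card: "card S \<le> r" using rank_card_indpt[OF A S(1)] r by simp
  have span: "c \<in> span S" if c: "c \<in> set (cols A)" for c
  proof (rule ccontr)
    assume nc: "c \<notin> span S"
    then have "lin_indpt (S \<union> {c})"
      using lin_dep_iff_in_span[OF Sv Sc(2)] c colsc Sv span_mem by blast
    with Sc c have "S \<union> {c} = S" using S(1) unfolding maximal_def by blast
    with nc Sv span_mem show False by blast
  qed
  have "\<exists>a. col A j = lincomb a S" if "j < p" for j
    using span[of "col A j"] that A finite_span[OF S(2) Sv] by (auto simp: cols_def)
  then obtain c where c: "\<And>j. j < p \<Longrightarrow> col A j = lincomb (c j) S" by metis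
  obtain h where h: "bij_betw h {..<card S} S"
    using ex_bij_betw_nat_finite[OF S(2)] by (auto simp: atLeast0LessThan)
  show thesis
  proof (rule that)
    fix i j assume ij: "i < n" "j < p"
    have "A $$ (i, j) = col A j $ i" using ij A by simp
    also have "\<dots> = (\<Sum>v\<in>S. v $ i * c j v)"
      using c[OF ij(2)] lincomb_index[OF ij(1) Sv] by (simp add: mult.commute)
    also have "\<dots> = (\<Sum>a<card S. h a $ i * c j (h a))"
      using h by (rule sum.reindex_bij_betw[symmetric])
    \<comment> \<open>The left factor is padded with zeros to exactly \<open>r\<close> terms, so the
      arbitrary values of \<open>h\<close> beyond \<open>card S\<close> do no harm.\<close>
    also have "\<dots> = (\<Sum>a<r. (if a < card S then h a $ i else 0) * c j (h a))"
      using card by (intro sum.mono_neutral_cong_left) auto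
    finally show "A $$ (i, j) = (\<Sum>a<r. (if a < card S then h a $ i else 0) * c j (h a))" .
  qed
qed

text \<open>Multiplication by \<open>M\<close> changes only the left factor of a rank factorization
  and keeps the number of terms.\<close>

lemma rank_mult_left:
  fixes A M :: "complex mat"
  assumes A: "A \<in> carrier_mat n p" and M: "M \<in> carrier_mat q n"
  shows "vec_space.rank q (M * A) \<le> vec_space.rank n A"
proof -
  obtain f g where fg: "\<And>i j. i < n \<Longrightarrow> j < p \<Longrightarrow> A $$ (i, j) = (\<Sum>a<vec_space.rank n A. f i a * g a j)"
    using rank_factorization[OF A order_refl] by blast
  have "vec_space.rank q (M * A) \<le> card {..<vec_space.rank n A}"
  proof (rule rank_le_cardI[of _ _ _ p "\<lambda>i a. \<Sum>l<n. M $$ (i, l) * f l a" g])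
    fix i j assume ij: "i < q" "j < p"
    have "(M * A) $$ (i, j) = (\<Sum>l<n. \<Sum>a<vec_space.rank n A. M $$ (i, l) * (f l a * g a j))"
      using ij by (simp add: mat_mult_index_sum[OF M A] fg sum_distrib_left)
    also have "\<dots> = (\<Sum>a<vec_space.rank n A. (\<Sum>l<n. M $$ (i, l) * f l a) * g a j)"
      by (subst sum.swap) (simp add: sum_distrib_right mult.assoc)
    finally show "(M * A) $$ (i, j) = (\<Sum>a<vec_space.rank n A. (\<Sum>l<n. M $$ (i, l) * f l a) * g a j)" .
  qed (use A M in auto)
  then show ?thesis by simp
qed

lemma rank_adjoint_le:
  fixes A :: "complex mat"
  assumes A: "A \<in> carrier_mat n p"
  shows "vec_space.rank p (mat_adjoint A) \<le> vec_space.rank n A"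
proof -
  obtain f g where fg: "\<And>i j. i < n \<Longrightarrow> j < p \<Longrightarrow> A $$ (i, j) = (\<Sum>a<vec_space.rank n A. f i a * g a j)"
    using rank_factorization[OF A order_refl] by blast
  have "vec_space.rank p (mat_adjoint A) \<le> card {..<vec_space.rank n A}"
    by (rule rank_le_cardI[of _ _ _ n "\<lambda>i a. cnj (g a i)" "\<lambda>a j. cnj (f j a)"])
      (use A in \<open>auto simp: fg mult.commute\<close>)
  then show ?thesis by simp
qed

lemma rank_mult_right:
  fixes A M :: "complex mat"
  assumes A: "A \<in> carrier_mat n p" and M: "M \<in> carrier_mat p q"
  shows "vec_space.rank n (A * M) \<le> vec_space.rank n A"
proof -
  have "vec_space.rank n (A * M) = vec_space.rank n (mat_adjoint (mat_adjoint M * mat_adjoint A))"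
    by (simp add: mat_adjoint_mult[OF A M, symmetric])
  also have "\<dots> \<le> vec_space.rank q (mat_adjoint M * mat_adjoint A)"
    by (rule rank_adjoint_le) (use A M in auto)
  also have "\<dots> \<le> vec_space.rank p (mat_adjoint A)"
    by (rule rank_mult_left) (use A M in auto)
  also have "\<dots> \<le> vec_space.rank n A" by (rule rank_adjoint_le[OF A])
  finally show ?thesis .
qed

text \<open>Padding both factors to square matrices, the second one with a zero row, makes the
  determinant of the product vanish.\<close>

lemma identity_not_low_rank:
  fixes f g :: "nat \<Rightarrow> nat \<Rightarrow> complex"
  assumes "r < t" "\<And>i j. i < t \<Longrightarrow> j < t \<Longrightarrow> (\<Sum>a<r. f i a * g a j) = (if i = j then 1 else 0)"
  shows False
proof -
  define F where "F = mat t t (\<lambda>(i, a). if a < r then f i a else 0)"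
  define G where "G = mat t t (\<lambda>(a, j). if a < r then g a j else 0)"
  have c: "F \<in> carrier_mat t t" "G \<in> carrier_mat t t" by (auto simp: F_def G_def)
  have "F * G = 1\<^sub>m t"
  proof (rule eq_matI)
    fix i j assume "i < dim_row (1\<^sub>m t :: complex mat)" "j < dim_col (1\<^sub>m t :: complex mat)"
    then have ij: "i < t" "j < t" by auto
    have "(F * G) $$ (i, j) = (\<Sum>a<t. (if a < r then f i a * g a j else 0))"
      using ij by (subst mat_mult_index_sum[OF c]) (auto simp: F_def G_def intro!: sum.cong)
    also have "\<dots> = (\<Sum>a<r. f i a * g a j)"
      using \<open>r < t\<close> by (intro sum.mono_neutral_cong_right) auto
    finally show "(F * G) $$ (i, j) = (1\<^sub>m t :: complex mat) $$ (i, j)" using assms(2) ij by simp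
  qed (use c in auto)
  then have "det F * det G = 1" using det_mult[OF c] by simp
  moreover have "det G = 0"
    using \<open>r < t\<close> by (subst laplace_expansion_row[OF c(2), of r]) (auto simp: G_def)
  ultimately show False by simp
qed

subsection \<open>Left singular vectors and truncations\<close>

text \<open>This simp rule would rewrite the entries of products to scalar products of rows and columns
  before \<open>mat_mult_index_sum\<close> applies.\<close>

declare index_mult_mat(1) [simp del]

section \<open>The trace inner product and the Frobenius norm\<close>

lemma mat_inner_sum:
  assumes "X \<in> carrier_mat n p" "Y \<in> carrier_mat n p"
  shows "mat_inner X Y = (\<Sum>i<n. \<Sum>j<p. X $$ (i, j) * cnj (Y $$ (i, j)))"
  using assms unfolding mat_inner_def
  by (intro sum.cong) (auto simp: mat_mult_index_sum[of X n p "mat_adjoint Y" n])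

lemma mat_inner_add_left:
  assumes "X \<in> carrier_mat n p" "X' \<in> carrier_mat n p" "Y \<in> carrier_mat n p"
  shows "mat_inner (X + X') Y = mat_inner X Y + mat_inner X' Y"
  using assms by (simp add: mat_inner_sum[of _ n p] sum.distrib algebra_simps)

lemma mat_inner_add_right:
  assumes "X \<in> carrier_mat n p" "Y \<in> carrier_mat n p" "Y' \<in> carrier_mat n p"
  shows "mat_inner X (Y + Y') = mat_inner X Y + mat_inner X Y'"
  using assms by (simp add: mat_inner_sum[of _ n p] sum.distrib algebra_simps)

lemma mat_inner_smult_left:
  assumes "X \<in> carrier_mat n p" "Y \<in> carrier_mat n p"
  shows "mat_inner (c \<cdot>\<^sub>m X) Y = c * mat_inner X Y"
  using assms by (simp add: mat_inner_sum[of _ n p] sum_distrib_left mult.assoc)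

lemma mat_inner_smult_right:
  assumes "X \<in> carrier_mat n p" "Y \<in> carrier_mat n p"
  shows "mat_inner X (c \<cdot>\<^sub>m Y) = cnj c * mat_inner X Y"
  using assms by (simp add: mat_inner_sum[of _ n p] sum_distrib_left mult.left_commute)

lemma mat_inner_commute:
  assumes "X \<in> carrier_mat n p" "Y \<in> carrier_mat n p"
  shows "mat_inner Y X = cnj (mat_inner X Y)"
  using assms by (simp add: mat_inner_sum[of _ n p] mult.commute)

lemma mat_inner_mult_left:
  assumes M: "M \<in> carrier_mat n q" and X: "X \<in> carrier_mat q p" and Y: "Y \<in> carrier_mat n p"
  shows "mat_inner (M * X) Y = mat_inner X (mat_adjoint M * Y)"
proof -
  have "mat_inner (M * X) Y = (\<Sum>i<n. \<Sum>j<p. \<Sum>l<q. M $$ (i, l) * X $$ (l, j) * cnj (Y $$ (i, j)))"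
    using Y by (subst mat_inner_sum[of _ n p])
      (use M X in \<open>auto simp: mat_mult_index_sum[OF M X] sum_distrib_right\<close>)
  also have "\<dots> = (\<Sum>i<n. \<Sum>l<q. \<Sum>j<p. M $$ (i, l) * X $$ (l, j) * cnj (Y $$ (i, j)))"
    by (intro sum.cong[OF refl] sum.swap)
  also have "\<dots> = (\<Sum>l<q. \<Sum>i<n. \<Sum>j<p. M $$ (i, l) * X $$ (l, j) * cnj (Y $$ (i, j)))"
    by (rule sum.swap)
  also have "\<dots> = (\<Sum>l<q. \<Sum>j<p. \<Sum>i<n. M $$ (i, l) * X $$ (l, j) * cnj (Y $$ (i, j)))"
    by (intro sum.cong[OF refl] sum.swap)
  also have "\<dots> = mat_inner X (mat_adjoint M * Y)"
    by (subst mat_inner_sum[of _ q p])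
      (use M X Y in \<open>auto simp: mat_mult_index_sum[of "mat_adjoint M" q n Y p] sum_distrib_left mult_ac
        intro!: sum.cong\<close>)
  finally show ?thesis .
qed

lemma mat_inner_adjoint:
  assumes "X \<in> carrier_mat n p" "Y \<in> carrier_mat n p"
  shows "mat_inner (mat_adjoint X) (mat_adjoint Y) = mat_inner Y X"
proof -
  have "mat_inner (mat_adjoint X) (mat_adjoint Y) = (\<Sum>j<p. \<Sum>i<n. Y $$ (i, j) * cnj (X $$ (i, j)))"
    using assms by (subst mat_inner_sum[of _ p n]) (auto simp: mult.commute)
  also have "\<dots> = mat_inner Y X"
    using assms by (subst mat_inner_sum[of _ n p]) (auto intro: sum.swap)
  finally show ?thesis .
qed

lemma mat_inner_mult_right:
  assumes X: "X \<in> carrier_mat n q" and M: "M \<in> carrier_mat q p" and Y: "Y \<in> carrier_mat n p"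
  shows "mat_inner (X * M) Y = mat_inner X (Y * mat_adjoint M)"
proof -
  have "mat_inner (X * M) Y = mat_inner (mat_adjoint Y) (mat_adjoint M * mat_adjoint X)"
    using mat_inner_adjoint[of Y n p "X * M"] assms by (simp add: mat_adjoint_mult[OF X M])
  also have "\<dots> = cnj (mat_inner (mat_adjoint M * mat_adjoint X) (mat_adjoint Y))"
    by (rule mat_inner_commute) (use assms in auto)
  also have "mat_inner (mat_adjoint M * mat_adjoint X) (mat_adjoint Y)
      = mat_inner (mat_adjoint X) (M * mat_adjoint Y)"
    using mat_inner_mult_left[of "mat_adjoint M" p q "mat_adjoint X" n "mat_adjoint Y"] assms by simp
  also have "\<dots> = mat_inner (Y * mat_adjoint M) X"
    using mat_inner_adjoint[of X n q "Y * mat_adjoint M"] assms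
    by (simp add: mat_adjoint_mult[of Y n p "mat_adjoint M" q])
  finally show ?thesis
    using mat_inner_commute[of "Y * mat_adjoint M" n q X] assms by simp
qed

lemma mat_inner_self:
  assumes "X \<in> carrier_mat n p"
  shows "mat_inner X X = of_real (\<Sum>i<n. \<Sum>j<p. (cmod (X $$ (i, j)))\<^sup>2)"
  by (simp add: mat_inner_sum[OF assms assms] complex_norm_square[symmetric])

lemma frob_norm_sq:
  assumes "X \<in> carrier_mat n p"
  shows "(frob_norm X)\<^sup>2 = (\<Sum>i<n. \<Sum>j<p. (cmod (X $$ (i, j)))\<^sup>2)"
  unfolding frob_norm_def mat_inner_self[OF assms] by (simp add: sum_nonneg)

lemma frob_norm_sq_inner:
  assumes "X \<in> carrier_mat n p"
  shows "(frob_norm X)\<^sup>2 = Re (mat_inner X X)"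
  unfolding frob_norm_sq[OF assms] mat_inner_self[OF assms] by simp

lemma frob_norm_nonneg:
  assumes "X \<in> carrier_mat n p"
  shows "0 \<le> frob_norm X"
  unfolding frob_norm_def mat_inner_self[OF assms] by (simp add: sum_nonneg)

lemma frob_norm_eq_0D:
  assumes "X \<in> carrier_mat n p" "frob_norm X = 0"
  shows "X = 0\<^sub>m n p"
proof -
  have "(\<Sum>i<n. \<Sum>j<p. (cmod (X $$ (i, j)))\<^sup>2) = 0"
    using frob_norm_sq[OF assms(1)] assms(2) by simp
  then have "\<forall>i<n. \<forall>j<p. X $$ (i, j) = 0"
    by (simp add: sum_nonneg_eq_0_iff sum_nonneg)
  then show ?thesis using assms by (intro eq_matI) auto
qed

lemma frob_norm_add_sq:
  assumes "X \<in> carrier_mat n p" "Y \<in> carrier_mat n p" "Re (mat_inner X Y) = 0"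
  shows "(frob_norm (X + Y))\<^sup>2 = (frob_norm X)\<^sup>2 + (frob_norm Y)\<^sup>2"
  using assms mat_inner_commute[of X n p Y]
  by (simp add: frob_norm_sq_inner[of _ n p] mat_inner_add_left[of _ n p] mat_inner_add_right[of _ n p])

section \<open>Singular values, truncations and the rank\<close>

text \<open>The rows of \<open>mat_adjoint U * A\<close> stand in for right singular vectors. The
  sequence \<open>s\<close> is total and vanishes from \<open>n\<close> on, so that blocks of
  indices may run past \<open>n\<close>. The last assumption ties \<open>s\<close> to the definition
  through roots of the characteristic polynomial.\<close>

locale left_svd =
  fixes n p :: nat and A U :: "complex mat" and s :: "nat \<Rightarrow> real"
  assumes A: "A \<in> carrier_mat n p" and U: "U \<in> carrier_mat n n"
    and unitary: "mat_adjoint U * U = 1\<^sub>m n"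
    and gram: "mat_adjoint U * (A * mat_adjoint A) * U
      = mat n n (\<lambda>(i, j). if i = j then of_real ((s i)\<^sup>2) else 0)"
    and s_nonneg: "0 \<le> s i" and s_decseq: "decseq s" and s_ge_n: "n \<le> i \<Longrightarrow> s i = 0"
    and singular_values: "singular_values A = image_mset s (mset_set {..<n})"

text \<open>The eigenvalues of \<open>A * mat_adjoint A\<close> are the squared norms of the rows of
  \<open>mat_adjoint U * A\<close>, hence real and nonnegative, and \<open>s\<close> takes their
  square roots.\<close>

lemma left_svd_exists:
  assumes A: "A \<in> carrier_mat n p"
  obtains U s where "left_svd n p A U s"
proof -
  define H where "H = A * mat_adjoint A"
  have H: "H \<in> carrier_mat n n" using A by (simp add: H_def)
  have H_adj: "mat_adjoint H = H"
    using A by (simp add: H_def mat_adjoint_mult[of A n p "mat_adjoint A" n])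
  obtain es0 where es0: "char_poly H = (\<Prod>e\<leftarrow>es0. [:- e, 1:])" "length es0 = n"
    using char_poly_factorized[OF H] by blast
  \<comment> \<open>Sorting comes before diagonalizing, when the eigenvalues are not yet known to be
    real; hence the key \<open>Re\<close>. The factorization of the characteristic polynomial does
    not depend on the order.\<close>
  define es where "es = rev (sort_key Re es0)"
  have mset_es: "mset es = mset es0" and len: "length es = n" using es0 by (auto simp: es_def)
  have cp: "char_poly H = (\<Prod>e\<leftarrow>es. [:- e, 1:])"
    unfolding es0(1) prod_mset_prod_list[symmetric] mset_map mset_es ..
  obtain U where U: "U \<in> carrier_mat n n" "mat_adjoint U * U = 1\<^sub>m n"
    "mat_adjoint U * H * U = mat n n (\<lambda>(i, j). if i = j then es ! i else 0)"
    using hermitian_diagonalization[OF H H_adj cp] by blast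
  define B where "B = mat_adjoint U * A"
  have B: "B \<in> carrier_mat n p" using U(1) A by (simp add: B_def)
  have BB: "mat_adjoint U * H * U = B * mat_adjoint B"
    using U(1) A unfolding B_def H_def
    by (simp add: mat_adjoint_mult[of "mat_adjoint U" n n A p] assoc_mult_mat[of _ n n _ n _ n]
      assoc_mult_mat[of _ n n _ p _ n] assoc_mult_mat[of _ n p _ n _ n])
  define l where "l i = (\<Sum>j<p. (cmod (B $$ (i, j)))\<^sup>2)" for i
  have es: "es ! i = of_real (l i)" if "i < n" for i
  proof -
    have "es ! i = (B * mat_adjoint B) $$ (i, i)" using that by (simp add: BB[symmetric] U(3))
    also have "\<dots> = of_real (l i)"
      using that B by (simp add: mat_mult_index_sum[OF B, of _ n] l_def complex_norm_square[symmetric])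
    finally show ?thesis .
  qed
  define s where "s i = (if i < n then sqrt (l i) else 0)" for i
  have l0: "0 \<le> l i" for i by (simp add: l_def sum_nonneg)
  have l_mono: "l j \<le> l i" if "i \<le> j" "j < n" for i j
  proof -
    have "sorted (map Re (rev es))" by (simp add: es_def)
    then have "Re (rev es ! (n - Suc j)) \<le> Re (rev es ! (n - Suc i))"
      using that len by (auto simp: sorted_iff_nth_mono)
    then show ?thesis using that len es by (simp add: rev_nth)
  qed
  have "left_svd n p A U s"
  proof
    show "mat_adjoint U * (A * mat_adjoint A) * U
      = mat n n (\<lambda>(i, j). if i = j then of_real ((s i)\<^sup>2) else 0)"
      unfolding H_def[symmetric] U(3) using es l0 by (intro eq_matI) (auto simp: s_def)
    show "decseq s" unfolding decseq_def s_def using l_mono l0 by (auto intro: order_trans)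
    have "singular_values A = image_mset (\<lambda>z. sqrt (Re z)) (mset es)"
    proof -
      have "proots (\<Prod>e\<leftarrow>xs. [:- e, 1:]) = mset xs" for xs :: "complex list"
      proof (induction xs)
        case (Cons a xs)
        have "(\<Prod>e\<leftarrow>xs. [:- e, 1:]) \<noteq> 0" by (auto simp: prod_list_zero_iff)
        then show ?case using Cons by (simp add: proots_mult del: mult_pCons_left)
      qed simp
      then show ?thesis unfolding singular_values_def H_def[symmetric] cp by simp
    qed
    also have "mset es = image_mset ((!) es) (mset_set {..<n})"
      by (metis len map_nth mset_map mset_upt atLeast0LessThan)
    also have "image_mset (\<lambda>z. sqrt (Re z)) \<dots> = image_mset s (mset_set {..<n})"
      by (auto simp: image_mset.compositionality s_def es intro!: image_mset_cong)
    finally show "singular_values A = image_mset s (mset_set {..<n})" .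
  qed (use A U l0 in \<open>auto simp: s_def\<close>)
  then show thesis by (rule that)
qed

context left_svd
begin

lemma nuclear_norm_eq: "nuclear_norm A = (\<Sum>i<n. s i)"
  unfolding nuclear_norm_def singular_values by (simp add: sum_unfold_sum_mset)

text \<open>For a decomposition of \<open>A\<close> as \<open>U\<close> times a diagonal matrix
  times the adjoint of \<open>V\<close>, this is the product of the last two factors: row
  \<open>i\<close> is the conjugated right singular vector scaled by \<open>s i\<close>.\<close>

definition B where "B = mat_adjoint U * A"

lemma B: "B \<in> carrier_mat n p" using A U by (simp add: B_def)

lemma U_mult_B: "U * B = A"
  using unitary_mult_adjoint[OF U unitary] A U
  by (simp add: B_def assoc_mult_mat[of U n n "mat_adjoint U" n A p, symmetric])

lemma B_rows_orthogonal:
  assumes "i < n" "k < n"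
  shows "(\<Sum>j<p. B $$ (i, j) * cnj (B $$ (k, j))) = (if i = k then of_real ((s i)\<^sup>2) else 0)"
proof -
  have "mat_adjoint U * (A * mat_adjoint A) * U = B * mat_adjoint B"
    using U A unfolding B_def
    by (simp add: mat_adjoint_mult[of "mat_adjoint U" n n A p] assoc_mult_mat[of _ n n _ n _ n]
      assoc_mult_mat[of _ n n _ p _ n] assoc_mult_mat[of _ n p _ n _ n])
  then have "B * mat_adjoint B = mat n n (\<lambda>(i, j). if i = j then of_real ((s i)\<^sup>2) else 0)"
    using gram by (simp only:)
  then have "(B * mat_adjoint B) $$ (i, k) = (if i = k then of_real ((s i)\<^sup>2) else 0)"
    using assms by simp
  then show ?thesis using assms B by (simp add: mat_mult_index_sum[OF B, of _ n])
qed

definition D :: "nat set \<Rightarrow> complex mat" where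
  "D T = mat n n (\<lambda>(i, j). if i = j \<and> i \<in> T then 1 else 0)"

lemma D: "D T \<in> carrier_mat n n" by (simp add: D_def)

lemma D_mult: "X \<in> carrier_mat n q \<Longrightarrow> D T * X = mat n q (\<lambda>(i, j). if i \<in> T then X $$ (i, j) else 0)"
proof (rule eq_matI)
  fix i j
  assume X: "X \<in> carrier_mat n q" and "i < dim_row (mat n q (\<lambda>(i, j). if i \<in> T then X $$ (i, j) else 0))"
    "j < dim_col (mat n q (\<lambda>(i, j). if i \<in> T then X $$ (i, j) else 0))"
  then have ij: "i < n" "j < q" by auto
  have "(D T * X) $$ (i, j) = (\<Sum>l<n. if l = i then (if l \<in> T then X $$ (l, j) else 0) else 0)"
    using ij by (subst mat_mult_index_sum[OF D X])
      (auto simp: D_def if_distrib[of "\<lambda>x. x * _"] intro!: sum.cong cong: if_cong)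
  then show "(D T * X) $$ (i, j) = mat n q (\<lambda>(i, j). if i \<in> T then X $$ (i, j) else 0) $$ (i, j)"
    using ij by simp
qed (auto simp: D_def)

text \<open>The orthogonal projection onto the span of the columns of \<open>U\<close> with index in
  \<open>T\<close>.\<close>

definition proj :: "nat set \<Rightarrow> complex mat" where
  "proj T = U * D T * mat_adjoint U"

lemma proj_carrier: "proj T \<in> carrier_mat n n" using U D by (auto simp: proj_def)

lemma proj_adjoint: "mat_adjoint (proj T) = proj T"
proof -
  have "mat_adjoint (D T) = D T" by (rule eq_matI) (auto simp: D_def)
  then show ?thesis unfolding proj_def using U D[of T]
    by (simp add: mat_adjoint_mult[of _ n n _ n] assoc_mult_mat[of _ n n _ n _ n])
qed

lemma proj_idem: "proj T * proj T = proj T"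
proof -
  have "proj T * proj T = U * (D T * ((mat_adjoint U * U) * (D T * mat_adjoint U)))"
    unfolding proj_def using U D[of T] by (simp add: assoc_mult_mat[of _ n n _ n _ n])
  also have "\<dots> = U * ((D T * D T) * mat_adjoint U)"
    unfolding unitary using U D[of T]
    by (simp add: left_mult_one_mat[of _ n n] assoc_mult_mat[of _ n n _ n _ n])
  also have "D T * D T = D T"
    unfolding D_mult[OF D] by (rule eq_matI) (auto simp: D_def)
  finally show ?thesis using U D[of T] by (simp add: proj_def assoc_mult_mat[of _ n n _ n _ n])
qed

lemma rank_proj:
  assumes "finite T"
  shows "vec_space.rank n (proj T) \<le> card T"
proof -
  have "vec_space.rank n (proj T) \<le> vec_space.rank n (U * D T)"
    unfolding proj_def by (rule rank_mult_right) (use U D in auto)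
  also have "\<dots> \<le> vec_space.rank n (D T)" by (rule rank_mult_left[OF D U])
  also have "\<dots> \<le> card T"
  proof (rule rank_le_cardI[OF assms D])
    fix i j assume "i < n" "j < n"
    then show "D T $$ (i, j) = (\<Sum>a\<in>T. (if a = i then 1 else 0) * (if a = j then 1 else 0))"
      using assms by (auto simp: D_def if_distrib[of "\<lambda>x. x * _"] cong: if_cong)
  qed
  finally show ?thesis .
qed

text \<open>As a product with \<open>A\<close> on the right, a truncation inherits rank bounds and
  identities under right multiplication; the form in \<open>trunc_eq\<close> serves for entries and
  inner products.\<close>

definition trunc :: "nat set \<Rightarrow> complex mat" where
  "trunc T = proj T * A"

definition rows_in :: "nat set \<Rightarrow> complex mat" where
  "rows_in T = mat n p (\<lambda>(i, j). if i \<in> T then B $$ (i, j) else 0)"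

lemma rows_in: "rows_in T \<in> carrier_mat n p" by (simp add: rows_in_def)

lemma trunc_carrier: "trunc T \<in> carrier_mat n p" unfolding trunc_def by (rule mult_carrier_mat[OF proj_carrier A])

lemma trunc_eq: "trunc T = U * rows_in T"
proof -
  have "trunc T = U * (D T * B)"
    unfolding trunc_def proj_def B_def using U D[of T] A
    by (simp add: assoc_mult_mat[of _ n n _ n _ n] assoc_mult_mat[of _ n n _ n _ p])
  then show ?thesis unfolding D_mult[OF B] rows_in_def .
qed

lemma trunc_index:
  assumes "i < n" "j < p"
  shows "trunc T $$ (i, j) = (\<Sum>a\<in>T \<inter> {..<n}. U $$ (i, a) * B $$ (a, j))"
proof -
  have "trunc T $$ (i, j) = (\<Sum>a<n. if a \<in> T then U $$ (i, a) * B $$ (a, j) else 0)"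
    using assms unfolding trunc_eq
    by (subst mat_mult_index_sum[OF U rows_in]) (auto simp: rows_in_def intro!: sum.cong)
  then show ?thesis by (simp add: sum.inter_restrict[symmetric] Int_commute)
qed

lemma trunc_Un:
  assumes "T \<inter> T' = {}"
  shows "trunc (T \<union> T') = trunc T + trunc T'"
proof (rule eq_matI)
  fix i j assume "i < dim_row (trunc T + trunc T')" "j < dim_col (trunc T + trunc T')"
  then have ij: "i < n" "j < p" using carrier_matD[OF trunc_carrier[of T']] by simp_all
  have "(T \<union> T') \<inter> {..<n} = (T \<inter> {..<n}) \<union> (T' \<inter> {..<n})" "(T \<inter> {..<n}) \<inter> (T' \<inter> {..<n}) = {}"
    using assms by blast+
  then have "trunc (T \<union> T') $$ (i, j) = trunc T $$ (i, j) + trunc T' $$ (i, j)"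
    unfolding trunc_index[OF ij] by (simp add: sum.union_disjoint)
  then show "trunc (T \<union> T') $$ (i, j) = (trunc T + trunc T') $$ (i, j)"
    using ij carrier_matD[OF trunc_carrier[of T']] by simp
qed (simp_all add: carrier_matD[OF trunc_carrier])

lemma rank_trunc: "finite T \<Longrightarrow> vec_space.rank n (trunc T) \<le> card T"
  unfolding trunc_def using rank_mult_right[OF proj_carrier A] rank_proj order_trans by blast

text \<open>The unitary factor drops out, and the mutually orthogonal rows of \<open>B\<close> leave
  only the indices common to both sets.\<close>

lemma inner_trunc: "mat_inner (trunc T) (trunc T') = of_real (\<Sum>i\<in>T \<inter> T' \<inter> {..<n}. (s i)\<^sup>2)"
proof -
  have "mat_inner (trunc T) (trunc T') = mat_inner (rows_in T) (mat_adjoint U * (U * rows_in T'))"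
    unfolding trunc_eq by (rule mat_inner_mult_left[OF U rows_in]) (use U rows_in in auto)
  also have "mat_adjoint U * (U * rows_in T') = rows_in T'"
    using U unitary rows_in[of T'] by (simp add: assoc_mult_mat[of _ n n U n _ p, symmetric])
  also have "mat_inner (rows_in T) (rows_in T')
      = (\<Sum>i<n. if i \<in> T \<inter> T' then (\<Sum>j<p. B $$ (i, j) * cnj (B $$ (i, j))) else 0)"
    unfolding mat_inner_sum[OF rows_in rows_in] by (intro sum.cong) (auto simp: rows_in_def)
  also have "\<dots> = (\<Sum>i<n. if i \<in> T \<inter> T' then of_real ((s i)\<^sup>2) else 0)"
    by (intro sum.cong) (auto simp: B_rows_orthogonal)
  also have "\<dots> = (\<Sum>i\<in>{..<n} \<inter> (T \<inter> T'). of_real ((s i)\<^sup>2))"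
    by (rule sum.inter_restrict[symmetric]) simp
  also have "\<dots> = of_real (\<Sum>i\<in>T \<inter> T' \<inter> {..<n}. (s i)\<^sup>2)"
    by (simp add: Int_ac)
  finally show ?thesis .
qed

lemma frob_norm_trunc: "(frob_norm (trunc T))\<^sup>2 = (\<Sum>i\<in>T \<inter> {..<n}. (s i)\<^sup>2)"
  unfolding frob_norm_sq_inner[OF trunc_carrier] inner_trunc by simp

lemma B_zero_row:
  assumes "i < n" "s i = 0" "j < p"
  shows "B $$ (i, j) = 0"
proof -
  have "complex_of_real (\<Sum>j<p. (cmod (B $$ (i, j)))\<^sup>2) = 0"
    using B_rows_orthogonal[of i i] assms by (simp add: complex_norm_square[symmetric])
  then have "(\<Sum>j<p. (cmod (B $$ (i, j)))\<^sup>2) = 0" unfolding of_real_eq_0_iff .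
  then show ?thesis using assms by (simp add: sum_nonneg_eq_0_iff)
qed

lemma trunc_all:
  assumes "\<And>i. i \<notin> T \<Longrightarrow> s i = 0"
  shows "trunc T = A"
proof -
  have "rows_in T = B" by (rule eq_matI) (use B assms B_zero_row in \<open>auto simp: rows_in_def\<close>)
  then show ?thesis by (simp add: trunc_eq U_mult_B)
qed

text \<open>With \<open>N = M * U\<close> the hypothesis reads \<open>N * B = 0\<close>. Pairing
  this with row \<open>k\<close> of \<open>B\<close> shows that column \<open>k\<close> of
  \<open>N\<close> vanishes unless \<open>s k = 0\<close>, and in that case row \<open>k\<close> of
  \<open>B\<close> vanishes.\<close>

lemma mult_trunc_eq_0:
  assumes M: "M \<in> carrier_mat q n" and 0: "M * A = 0\<^sub>m q p"
  shows "M * trunc T = 0\<^sub>m q p"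
proof -
  define N where "N = M * U"
  have N: "N \<in> carrier_mat q n" using M U by (simp add: N_def)
  have NB: "N * B = 0\<^sub>m q p"
    using 0 M U B by (simp add: N_def U_mult_B)
  have key: "N $$ (a, k) * (s k)\<^sup>2 = 0" if "a < q" "k < n" for a k
  proof -
    have "0 = (\<Sum>j<p. (N * B) $$ (a, j) * cnj (B $$ (k, j)))" using that by (simp add: NB)
    also have "\<dots> = (\<Sum>j<p. \<Sum>i<n. N $$ (a, i) * (B $$ (i, j) * cnj (B $$ (k, j))))"
      using that by (simp add: mat_mult_index_sum[OF N B] sum_distrib_right mult.assoc)
    also have "\<dots> = (\<Sum>i<n. N $$ (a, i) * (\<Sum>j<p. B $$ (i, j) * cnj (B $$ (k, j))))"
      by (subst sum.swap) (simp add: sum_distrib_left)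
    also have "\<dots> = (\<Sum>i<n. if i = k then N $$ (a, k) * (s k)\<^sup>2 else 0)"
      using that by (intro sum.cong) (auto simp: B_rows_orthogonal)
    finally show ?thesis using that by simp
  qed
  have "M * trunc T = N * rows_in T"
    using M U rows_in by (simp add: trunc_eq N_def assoc_mult_mat[of M q n U n "rows_in T" p])
  also have "\<dots> = 0\<^sub>m q p"
  proof (rule eq_matI)
    fix a j assume "a < dim_row (0\<^sub>m q p :: complex mat)" "j < dim_col (0\<^sub>m q p :: complex mat)"
    then have aj: "a < q" "j < p" by auto
    have "N $$ (a, k) * rows_in T $$ (k, j) = 0" if "k < n" for k
      using key[OF aj(1) that] B_zero_row[OF that _ aj(2)] that aj by (auto simp: rows_in_def)
    then show "(N * rows_in T) $$ (a, j) = 0\<^sub>m q p $$ (a, j)"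
      using aj by (auto simp: mat_mult_index_sum[OF N rows_in] intro!: sum.neutral)
  qed (use N rows_in in auto)
  finally show ?thesis .
qed

lemma trunc_mult_right:
  assumes N: "N \<in> carrier_mat p p" and "A * N = A"
  shows "trunc T * N = trunc T"
  using proj_carrier A N assms(2) by (simp add: trunc_def assoc_mult_mat[of _ n n A p N p])

text \<open>If \<open>s i\<close> were nonzero, then by monotonicity so would be the first
  \<open>Suc i\<close> singular values. The corresponding rows of \<open>B\<close> are orthogonal
  and nonzero, and a rank factorization of \<open>A\<close> would factor the identity of size
  \<open>Suc i\<close> through at most \<open>i\<close> dimensions.\<close>

lemma s_eq_0_above_rank:
  assumes "vec_space.rank n A \<le> i"
  shows "s i = 0"
proof (rule ccontr)
  define r where "r = vec_space.rank n A"
  assume "s i \<noteq> 0"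
  then have i: "i < n" using s_ge_n[of i] by (cases "i < n") auto
  have nz: "s j \<noteq> 0" if "j < Suc i" for j
    using decseqD[OF s_decseq, of j i] s_nonneg[of i] \<open>s i \<noteq> 0\<close> that by auto
  obtain f g where fg: "\<And>i j. i < n \<Longrightarrow> j < p \<Longrightarrow> A $$ (i, j) = (\<Sum>a<r. f i a * g a j)"
    using rank_factorization[OF A, of r] unfolding r_def by blast
  define F where "F i a = (\<Sum>l<n. mat_adjoint U $$ (i, l) * f l a)" for i a
  \<comment> \<open>Pairing with row \<open>k\<close> of \<open>B\<close> and dividing by its
    squared norm \<open>(s k)\<^sup>2\<close> turns the orthogonality of the rows into a Kronecker
    delta.\<close>
  define G where "G a k = (\<Sum>j<p. g a j * cnj (B $$ (k, j))) / (s k)\<^sup>2" for a k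
  have BF: "B $$ (i, j) = (\<Sum>a<r. F i a * g a j)" if "i < n" "j < p" for i j
  proof -
    have "B $$ (i, j) = (\<Sum>l<n. \<Sum>a<r. mat_adjoint U $$ (i, l) * (f l a * g a j))"
      unfolding B_def using that U A
      by (simp add: mat_mult_index_sum[of _ n n A p] fg sum_distrib_left)
    also have "\<dots> = (\<Sum>a<r. F i a * g a j)"
      unfolding F_def by (subst sum.swap) (simp add: sum_distrib_right mult.assoc)
    finally show ?thesis .
  qed
  show False
  proof (rule identity_not_low_rank)
    show "r < Suc i" using assms by (simp add: r_def)
    fix k l assume kl: "k < Suc i" "l < Suc i"
    then have kn: "k < n" "l < n" using i by auto
    have "(\<Sum>a<r. F k a * G a l) = (\<Sum>a<r. \<Sum>j<p. F k a * g a j * cnj (B $$ (l, j))) / (s l)\<^sup>2"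
      by (simp add: G_def sum_divide_distrib sum_distrib_left mult.assoc)
    also have "(\<Sum>a<r. \<Sum>j<p. F k a * g a j * cnj (B $$ (l, j))) = (\<Sum>j<p. B $$ (k, j) * cnj (B $$ (l, j)))"
      by (subst sum.swap) (use kn in \<open>simp add: BF sum_distrib_right\<close>)
    also have "\<dots> / (s l)\<^sup>2 = (if k = l then 1 else 0)"
      using kn nz[OF kl(2)] by (simp add: B_rows_orthogonal)
    finally show "(\<Sum>a<r. F k a * G a l) = (if k = l then 1 else 0)" .
  qed
qed

text \<open>This is the Cauchy-Schwarz inequality for the at most \<open>r\<close> nonzero singular
  values.\<close>

lemma nuclear_norm_le:
  assumes "vec_space.rank n A \<le> r"
  shows "nuclear_norm A \<le> sqrt r * frob_norm A"
proof -
  have "i < r" "i < n" if "s i \<noteq> 0" for i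
    using that assms s_eq_0_above_rank[of i] s_ge_n[of i] by (force simp: not_less)+
  then have sums: "(\<Sum>i<n. s i) = (\<Sum>i<r. s i)" "(\<Sum>i<n. (s i)\<^sup>2) = (\<Sum>i<r. (s i)\<^sup>2)"
    by (auto intro!: sum.mono_neutral_cong)
  \<comment> \<open>Chebyshev's sum inequality for the increasing sequence \<open>- s\<close> and
    the decreasing sequence \<open>s\<close>; after the signs cancel it is the Cauchy-Schwarz
    bound.\<close>
  have "real r * (\<Sum>i=0..<r. - s i * s i) \<le> (\<Sum>i=0..<r. - s i) * (\<Sum>i=0..<r. s i)"
    by (intro Chebyshev_sum_upper) (auto intro: decseqD[OF s_decseq])
  then have "(\<Sum>i<r. s i)\<^sup>2 \<le> r * (\<Sum>i<r. (s i)\<^sup>2)"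
    by (simp add: sum_negf power2_eq_square atLeast0LessThan)
  also have "(\<Sum>i<r. (s i)\<^sup>2) = (frob_norm A)\<^sup>2"
    using frob_norm_trunc[of UNIV] trunc_all[of UNIV] by (simp add: sums)
  also have "r * \<dots> = (sqrt r * frob_norm A)\<^sup>2" by (simp add: power_mult_distrib)
  finally show ?thesis
    unfolding nuclear_norm_eq sums by (rule power2_le_imp_le) (simp add: frob_norm_nonneg[OF A])
qed

end

section \<open>Blocks of consecutive singular values\<close>

context left_svd
begin

lemma frob_norm_block_le:
  assumes "1 \<le> k"
  shows "sqrt k * frob_norm (trunc {Suc j * k..<Suc j * k + k}) \<le> (\<Sum>i=j * k..<j * k + k. s i)"
proof -
  \<comment> \<open>The first value of block \<open>Suc j\<close> separates the blocks: it is at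
    least every value in its own block and at most every value in block \<open>j\<close>.\<close>
  define t where "t = s (Suc j * k)"
  have t0: "0 \<le> t" by (simp add: t_def s_nonneg)
  have "(frob_norm (trunc {Suc j * k..<Suc j * k + k}))\<^sup>2 \<le> (\<Sum>i=Suc j * k..<Suc j * k + k. (s i)\<^sup>2)"
    unfolding frob_norm_trunc by (intro sum_mono2) auto
  also have "\<dots> \<le> (\<Sum>i=Suc j * k..<Suc j * k + k. t\<^sup>2)"
    unfolding t_def by (intro sum_mono power_mono decseqD[OF s_decseq]) (auto simp: s_nonneg)
  also have "\<dots> = k * t\<^sup>2" by simp
  finally have "k * (frob_norm (trunc {Suc j * k..<Suc j * k + k}))\<^sup>2 \<le> k * (k * t\<^sup>2)"
    by (rule mult_left_mono) simp
  then have "(sqrt k * frob_norm (trunc {Suc j * k..<Suc j * k + k}))\<^sup>2 \<le> (k * t)\<^sup>2"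
    by (simp add: power_mult_distrib power2_eq_square[of "real k"] mult.assoc)
  then have "sqrt k * frob_norm (trunc {Suc j * k..<Suc j * k + k}) \<le> k * t"
    by (rule power2_le_imp_le) (use t0 in simp)
  also have "\<dots> = (\<Sum>i=j * k..<j * k + k. t)" by simp
  also have "\<dots> \<le> (\<Sum>i=j * k..<j * k + k. s i)"
    unfolding t_def by (intro sum_mono decseqD[OF s_decseq]) auto
  finally show ?thesis .
qed

text \<open>The bounding sums over blocks \<open>0\<close> to \<open>N - 1\<close> join to one sum
  of \<open>s\<close> over an initial segment; indices from \<open>n\<close> on add nothing.\<close>

lemma sum_frob_norm_blocks_le:
  assumes "1 \<le> k"
  shows "sqrt k * (\<Sum>j<N. frob_norm (trunc {Suc j * k..<Suc j * k + k})) \<le> nuclear_norm A"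
proof -
  have "sqrt k * (\<Sum>j<N. frob_norm (trunc {Suc j * k..<Suc j * k + k}))
      \<le> (\<Sum>j<N. \<Sum>i=j * k..<j * k + k. s i)"
    unfolding sum_distrib_left by (intro sum_mono frob_norm_block_le[OF assms])
  also have "\<dots> = (\<Sum>i<N * k. s i)" by (rule sum.nat_group)
  also have "\<dots> = (\<Sum>i\<in>{..<N * k} \<inter> {..<n}. s i)"
    using s_ge_n not_less by (intro sum.mono_neutral_right) auto
  also have "\<dots> \<le> (\<Sum>i<n. s i)" by (intro sum_mono2) (auto simp: s_nonneg)
  finally show ?thesis unfolding nuclear_norm_eq .
qed

end

text \<open>The span of the first \<open>r\<close> left singular vectors contains the column space,
  since \<open>s\<close> vanishes from the rank on. It may be larger, but only the rank bound and
  \<open>P * A = A\<close> matter later.\<close>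

lemma column_space_projection:
  fixes A :: "complex mat"
  assumes A: "A \<in> carrier_mat n p" and r: "vec_space.rank n A \<le> r"
  obtains P where "P \<in> carrier_mat n n" "mat_adjoint P = P" "P * P = P" "P * A = A"
    "vec_space.rank n P \<le> r"
proof -
  obtain U s where "left_svd n p A U s" using left_svd_exists[OF A] .
  then interpret left_svd n p A U s .
  show thesis
  proof (rule that)
    show "proj {..<r} * A = A"
      using trunc_all[of "{..<r}"] s_eq_0_above_rank r unfolding trunc_def by auto
    show "vec_space.rank n (proj {..<r}) \<le> r" using rank_proj[of "{..<r}"] by simp
  qed (rule proj_carrier proj_adjoint proj_idem)+
qed

subsection \<open>Restricted isometries\<close>

text \<open>Only the real part is kept: it is the cross term in the squared norm of a real
  combination, which is all that the expansion of squares and the polarization produce.\<close>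

definition vec_re_inner :: "complex vec \<Rightarrow> complex vec \<Rightarrow> real" where
  "vec_re_inner v w = (\<Sum>i<dim_vec v. Re (v $ i * cnj (w $ i)))"

lemma vec_re_inner_add_right:
  assumes "v \<in> carrier_vec m" "w \<in> carrier_vec m" "w' \<in> carrier_vec m"
  shows "vec_re_inner v (w + w') = vec_re_inner v w + vec_re_inner v w'"
  using assms by (simp add: vec_re_inner_def sum.distrib algebra_simps)

lemma l2_norm_sq: "(l2_norm v)\<^sup>2 = (\<Sum>i<dim_vec v. (cmod (v $ i))\<^sup>2)"
  unfolding l2_norm_def by (simp add: sum_nonneg)

lemma l2_norm_sq_combination:
  assumes "v \<in> carrier_vec m" "w \<in> carrier_vec m"
  shows "(l2_norm (of_real a \<cdot>\<^sub>v v + of_real b \<cdot>\<^sub>v w))\<^sup>2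
    = a\<^sup>2 * (l2_norm v)\<^sup>2 + 2 * a * b * vec_re_inner v w + b\<^sup>2 * (l2_norm w)\<^sup>2"
proof -
  have "(cmod (of_real a * x + of_real b * y))\<^sup>2
      = a\<^sup>2 * (cmod x)\<^sup>2 + 2 * a * b * Re (x * cnj y) + b\<^sup>2 * (cmod y)\<^sup>2" for x y :: complex
    unfolding cmod_power2 by (simp add: power2_eq_square algebra_simps)
  then have "(\<Sum>i<m. (cmod (of_real a * v $ i + of_real b * w $ i))\<^sup>2)
      = (\<Sum>i<m. a\<^sup>2 * (cmod (v $ i))\<^sup>2 + 2 * a * b * Re (v $ i * cnj (w $ i)) + b\<^sup>2 * (cmod (w $ i))\<^sup>2)"
    by (simp only:)
  then show ?thesis
    using assms unfolding l2_norm_sq vec_re_inner_def by (simp only: sum.distrib sum_distrib_left) simp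
qed

lemma frob_norm_smult_sq:
  assumes X: "X \<in> carrier_mat n p"
  shows "(frob_norm (of_real c \<cdot>\<^sub>m X))\<^sup>2 = c\<^sup>2 * (frob_norm X)\<^sup>2"
proof -
  have "(frob_norm (of_real c \<cdot>\<^sub>m X))\<^sup>2 = Re (of_real c * (of_real c * mat_inner X X))"
    using X by (simp add: frob_norm_sq_inner[of _ n p] mat_inner_smult_left[of _ n p]
        mat_inner_smult_right[of _ n p])
  then show ?thesis unfolding frob_norm_sq_inner[OF X] by (simp add: power2_eq_square)
qed

section \<open>Linear measurement maps and their restricted isometry constants\<close>

locale measurement =
  fixes n p m :: nat and S :: "complex mat \<Rightarrow> complex vec"
  assumes linear: "mat_vec_linear n p m S"
begin

lemma S_carrier: "X \<in> carrier_mat n p \<Longrightarrow> S X \<in> carrier_vec m"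
  and S_add: "X \<in> carrier_mat n p \<Longrightarrow> Y \<in> carrier_mat n p \<Longrightarrow> S (X + Y) = S X + S Y"
  and S_smult: "X \<in> carrier_mat n p \<Longrightarrow> S (c \<cdot>\<^sub>m X) = c \<cdot>\<^sub>v S X"
proof -
  interpret lm: linear_map class_ring "module_mat TYPE(complex) n p" "module_vec TYPE(complex) m" S
    by (rule linear)
  show "X \<in> carrier_mat n p \<Longrightarrow> S X \<in> carrier_vec m"
    using lm.f_im by (auto simp: module_mat_simps module_vec_simps)
  show "X \<in> carrier_mat n p \<Longrightarrow> Y \<in> carrier_mat n p \<Longrightarrow> S (X + Y) = S X + S Y"
    using lm.f_add[of X Y] by (simp add: module_mat_simps module_vec_simps)
  show "X \<in> carrier_mat n p \<Longrightarrow> S (c \<cdot>\<^sub>m X) = c \<cdot>\<^sub>v S X"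
    using lm.f_smult[of c X] by (simp add: module_mat_simps module_vec_simps class_ring_simps)
qed

lemma S_zero: "S (0\<^sub>m n p) = 0\<^sub>v m"
proof -
  have "S (0 \<cdot>\<^sub>m 0\<^sub>m n p) = 0 \<cdot>\<^sub>v S (0\<^sub>m n p)" by (rule S_smult) simp
  then have eq: "S (0\<^sub>m n p) = 0 \<cdot>\<^sub>v S (0\<^sub>m n p)" by simp
  have c: "S (0\<^sub>m n p) \<in> carrier_vec m" by (rule S_carrier) simp
  show ?thesis by (subst eq, rule eq_vecI) (use c in simp_all)
qed

text \<open>Linearity is applied one entry at a time, by induction over the set of positions at
  which \<open>X\<close> is kept. It makes the boundedness of \<open>S\<close> a finite
  computation.\<close>

lemma S_expansion:
  assumes X: "X \<in> carrier_mat n p" and l: "l < m"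
  shows "S X $ l = (\<Sum>x\<in>{..<n} \<times> {..<p}. X $$ x * S (mat n p (\<lambda>y. if y = x then 1 else 0)) $ l)"
proof -
  define E where "E x = mat n p (\<lambda>y. if y = x then (1 :: complex) else 0)" for x
  define R where "R F = mat n p (\<lambda>y. if y \<in> F then X $$ y else 0)" for F
  have c: "E x \<in> carrier_mat n p" "R F \<in> carrier_mat n p" for x F by (auto simp: E_def R_def)
  have "S (R F) $ l = (\<Sum>x\<in>F. X $$ x * S (E x) $ l)" if "finite F" for F
    using that
  proof (induction F rule: finite_induct)
    case empty
    have "R {} = 0\<^sub>m n p" by (auto simp: R_def)
    then show ?case using l by (simp add: S_zero)
  next
    case (insert x F)
    have "R (insert x F) = R F + X $$ x \<cdot>\<^sub>m E x"
      using insert.hyps by (intro eq_matI) (auto simp: R_def E_def)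
    then have "S (R (insert x F)) = S (R F) + X $$ x \<cdot>\<^sub>v S (E x)"
      using c(1)[of x] c(2)[of F] by (simp add: S_add[of "R F" "X $$ x \<cdot>\<^sub>m E x"] S_smult)
    then have "S (R (insert x F)) $ l = S (R F) $ l + X $$ x * S (E x) $ l"
      using S_carrier[OF c(1)[of x]] S_carrier[OF c(2)[of F]] l by simp
    then show ?case using insert by (simp add: add.commute)
  qed
  from this[of "{..<n} \<times> {..<p}"]
  have "S (R ({..<n} \<times> {..<p})) $ l = (\<Sum>x\<in>{..<n} \<times> {..<p}. X $$ x * S (E x) $ l)" by simp
  also have "R ({..<n} \<times> {..<p}) = X" using X by (intro eq_matI) (auto simp: R_def)
  finally show ?thesis by (simp only: E_def)
qed

text \<open>A crude constant suffices: every entry is at most the Frobenius norm. The purpose is to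
  have some admissible restricted isometry constant at all.\<close>

lemma S_bounded: "\<exists>C. \<forall>X\<in>carrier_mat n p. (l2_norm (S X))\<^sup>2 \<le> C * (frob_norm X)\<^sup>2"
proof -
  define K where "K l = (\<Sum>x\<in>{..<n} \<times> {..<p}. cmod (S (mat n p (\<lambda>y. if y = x then 1 else 0)) $ l))" for l
  have "(l2_norm (S X))\<^sup>2 \<le> (\<Sum>l<m. (K l)\<^sup>2) * (frob_norm X)\<^sup>2" if X: "X \<in> carrier_mat n p" for X
  proof -
    have entry: "cmod (X $$ x) \<le> frob_norm X" if "x \<in> {..<n} \<times> {..<p}" for x
    proof (rule power2_le_imp_le)
      have "(cmod (X $$ x))\<^sup>2 \<le> (\<Sum>x\<in>{..<n} \<times> {..<p}. (cmod (X $$ x))\<^sup>2)"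
        using that by (intro member_le_sum) auto
      then show "(cmod (X $$ x))\<^sup>2 \<le> (frob_norm X)\<^sup>2"
        unfolding frob_norm_sq[OF X] by (simp add: sum.cartesian_product)
    qed (rule frob_norm_nonneg[OF X])
    have "cmod (S X $ l) \<le> K l * frob_norm X" if "l < m" for l
    proof -
      have "cmod (S X $ l) \<le> (\<Sum>x\<in>{..<n} \<times> {..<p}. frob_norm X
          * cmod (S (mat n p (\<lambda>y. if y = x then 1 else 0)) $ l))"
        unfolding S_expansion[OF X that]
        by (intro sum_norm_le) (auto simp: norm_mult intro!: mult_right_mono entry)
      then show ?thesis by (simp add: K_def sum_distrib_left sum_distrib_right mult.commute)
    qed
    then have "(\<Sum>l<m. (cmod (S X $ l))\<^sup>2) \<le> (\<Sum>l<m. (K l * frob_norm X)\<^sup>2)"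
      by (intro sum_mono power_mono) auto
    then show ?thesis
      using S_carrier[OF X] by (simp add: l2_norm_sq power_mult_distrib sum_distrib_right)
  qed
  then show ?thesis by blast
qed

text \<open>\<open>LEAST\<close> over the reals carries information only if a minimum exists. The
  admissible numbers form a nonempty set bounded below by 0, and their infimum is admissible because
  each \<open>X\<close> imposes only non-strict lower bounds on them.\<close>

lemma rip_const_least:
  assumes "1 \<le> n" "1 \<le> p" "1 \<le> k"
  shows "rip_bounds n p S k (rip_const n p S k)"
    and "rip_bounds n p S k \<delta> \<Longrightarrow> rip_const n p S k \<le> \<delta>"
proof -
  define \<Delta> where "\<Delta> = {\<delta>. rip_bounds n p S k \<delta>}"
  obtain C where C: "\<And>X :: complex mat. X \<in> carrier_mat n p \<Longrightarrow> (l2_norm (S X))\<^sup>2 \<le> C * (frob_norm X)\<^sup>2"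
    using S_bounded by blast
  \<comment> \<open>The value 1 makes the lower isometry bound trivial, the value \<open>C\<close>
    the upper one.\<close>
  have "max 1 C \<in> \<Delta>"
    unfolding \<Delta>_def rip_bounds_def mem_Collect_eq
  proof (intro ballI impI conjI)
    fix X :: "complex mat" assume X: "X \<in> carrier_mat n p"
    have "(1 - max 1 C) * (frob_norm X)\<^sup>2 \<le> 0" by (intro mult_nonpos_nonneg) auto
    then show "(1 - max 1 C) * (frob_norm X)\<^sup>2 \<le> (l2_norm (S X))\<^sup>2"
      using zero_le_power2 order_trans by blast
    have "C * (frob_norm X)\<^sup>2 \<le> (1 + max 1 C) * (frob_norm X)\<^sup>2" by (intro mult_right_mono) auto
    with C[OF X] show "(l2_norm (S X))\<^sup>2 \<le> (1 + max 1 C) * (frob_norm X)\<^sup>2" by linarith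
  qed
  then have ne: "\<Delta> \<noteq> {}" by blast
  have nonneg: "0 \<le> \<delta>" if "\<delta> \<in> \<Delta>" for \<delta>
  proof -
    \<comment> \<open>A nonzero test matrix of rank at most one: its two isometry bounds are
      compatible only for a nonnegative constant.\<close>
    define E where "E = mat n p (\<lambda>(i, j). if i = 0 \<and> j = 0 then (1 :: complex) else 0)"
    have E: "E \<in> carrier_mat n p" by (simp add: E_def)
    have "vec_space.rank n E \<le> card {0 :: nat}"
      by (rule rank_le_cardI[OF _ E, of _ "\<lambda>i a. if i = 0 then 1 else 0" "\<lambda>a j. if j = 0 then 1 else 0"])
        (auto simp: E_def)
    then have "(1 - \<delta>) * (frob_norm E)\<^sup>2 \<le> (1 + \<delta>) * (frob_norm E)\<^sup>2"
      using that E assms(3) unfolding \<Delta>_def rip_bounds_def by fastforce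
    moreover have "E \<noteq> 0\<^sub>m n p"
    proof
      assume "E = 0\<^sub>m n p"
      then have "E $$ (0, 0) = 0\<^sub>m n p $$ (0, 0)" by simp
      then show False using assms by (simp add: E_def)
    qed
    then have "frob_norm E \<noteq> 0" using frob_norm_eq_0D[OF E] by blast
    ultimately have "1 - \<delta> \<le> 1 + \<delta>" by (simp add: mult_le_cancel_right)
    then show ?thesis by simp
  qed
  then have bdd: "bdd_below \<Delta>" by (intro bdd_belowI)
  have Inf: "rip_bounds n p S k (Inf \<Delta>)"
    unfolding rip_bounds_def
  proof (intro ballI impI)
    fix X :: "complex mat" assume X: "X \<in> carrier_mat n p" and rk: "vec_space.rank n X \<le> k"
    show "(1 - Inf \<Delta>) * (frob_norm X)\<^sup>2 \<le> (l2_norm (S X))\<^sup>2 \<and>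
      (l2_norm (S X))\<^sup>2 \<le> (1 + Inf \<Delta>) * (frob_norm X)\<^sup>2"
    proof (cases "frob_norm X = 0")
      case True
      then show ?thesis using C[OF X] by simp
    next
      case False
      define N where "N = (l2_norm (S X))\<^sup>2 / (frob_norm X)\<^sup>2"
      have F: "(frob_norm X)\<^sup>2 > 0" using False by simp
      have "1 - N \<le> \<delta> \<and> N - 1 \<le> \<delta>" if "\<delta> \<in> \<Delta>" for \<delta>
        using that X rk F unfolding \<Delta>_def rip_bounds_def N_def by (auto simp: field_simps)
      then have "1 - N \<le> Inf \<Delta>" "N - 1 \<le> Inf \<Delta>" using ne by (auto intro!: cInf_greatest)
      then show ?thesis using F unfolding N_def by (auto simp: field_simps)
    qed
  qed
  have le: "Inf \<Delta> \<le> \<delta>" if "rip_bounds n p S k \<delta>" for \<delta>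
    by (rule cInf_lower[OF _ bdd]) (simp add: \<Delta>_def that)
  have "rip_const n p S k = Inf \<Delta>"
    unfolding rip_const_def by (intro Least_equality Inf le)
  then show "rip_bounds n p S k (rip_const n p S k)"
    and "rip_bounds n p S k \<delta> \<Longrightarrow> rip_const n p S k \<le> \<delta>"
    using Inf le by simp_all
qed

lemma rip_const_mono:
  assumes "1 \<le> n" "1 \<le> p" "1 \<le> k" "k \<le> k'"
  shows "rip_const n p S k \<le> rip_const n p S k'"
proof (rule rip_const_least(2))
  show "rip_bounds n p S k (rip_const n p S k')"
    using rip_const_least(1)[of k'] assms unfolding rip_bounds_def by auto
qed (use assms in auto)

text \<open>Polarization: for orthogonal \<open>A\<close> and \<open>B\<close> compare the images of \<open>t A + B\<close> and \<open>t A - B\<close>,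
  which have equal Frobenius norm, and optimize over \<open>t\<close>.\<close>

lemma rip_almost_orthogonal:
  assumes rip: "rip_bounds n p S k \<delta>" and A: "A \<in> carrier_mat n p" and B: "B \<in> carrier_mat n p"
    and rank: "vec_space.rank n A + vec_space.rank n B \<le> k" and orth: "mat_inner A B = 0"
  shows "\<bar>vec_re_inner (S A) (S B)\<bar> \<le> \<delta> * frob_norm A * frob_norm B"
proof (cases "frob_norm A = 0 \<or> frob_norm B = 0")
  case True
  then have "A = 0\<^sub>m n p \<or> B = 0\<^sub>m n p" using frob_norm_eq_0D A B by blast
  then have "S A = 0\<^sub>v m \<or> S B = 0\<^sub>v m" using S_zero by auto
  then have "vec_re_inner (S A) (S B) = 0"
    using S_carrier[OF A] by (auto simp: vec_re_inner_def)
  then show ?thesis using True by auto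
next
  case False
  define a b v where "a = frob_norm A" and "b = frob_norm B" and "v = vec_re_inner (S A) (S B)"
  have pos: "0 < a" "0 < b"
    using False frob_norm_nonneg[OF A] frob_norm_nonneg[OF B] by (auto simp: a_def b_def)
  define Z where "Z t c = of_real t \<cdot>\<^sub>m A + of_real c \<cdot>\<^sub>m B" for t c :: real
  have Zc: "Z t c \<in> carrier_mat n p" for t c using A B by (simp add: Z_def)
  have SZ: "(l2_norm (S (Z t c)))\<^sup>2 = t\<^sup>2 * (l2_norm (S A))\<^sup>2 + 2 * t * c * v + c\<^sup>2 * (l2_norm (S B))\<^sup>2" for t c
    using A B by (simp add: Z_def S_add S_smult l2_norm_sq_combination[OF S_carrier S_carrier] v_def)
  have FZ: "(frob_norm (Z t c))\<^sup>2 = t\<^sup>2 * a\<^sup>2 + c\<^sup>2 * b\<^sup>2" for t c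
  proof -
    have "(frob_norm (Z t c))\<^sup>2 = (frob_norm (of_real t \<cdot>\<^sub>m A))\<^sup>2 + (frob_norm (of_real c \<cdot>\<^sub>m B))\<^sup>2"
      unfolding Z_def using A B orth
      by (intro frob_norm_add_sq) (auto simp: mat_inner_smult_left[of _ n p] mat_inner_smult_right[of _ n p])
    then show ?thesis using A B by (simp add: frob_norm_smult_sq a_def b_def)
  qed
  \<comment> \<open>A scalar multiple is a left multiplication by a multiple of the
    identity.\<close>
  have rank_smult: "vec_space.rank n (c \<cdot>\<^sub>m X) \<le> vec_space.rank n X" if "X \<in> carrier_mat n p" for c and X :: "complex mat"
    using rank_mult_left[OF that, of "c \<cdot>\<^sub>m 1\<^sub>m n" n] that
    by (simp add: mult_smult_assoc_mat[of _ n n _ p])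
  have RZ: "vec_space.rank n (Z t c) \<le> k" for t c
    using vec_space.rank_subadditive[of "of_real t \<cdot>\<^sub>m A" n p "of_real c \<cdot>\<^sub>m B"]
      rank_smult[OF A, of "of_real t"] rank_smult[OF B, of "of_real c"] A B rank
    unfolding Z_def by simp
  have bounds: "(1 - \<delta>) * (t\<^sup>2 * a\<^sup>2 + c\<^sup>2 * b\<^sup>2) \<le> (l2_norm (S (Z t c)))\<^sup>2"
    "(l2_norm (S (Z t c)))\<^sup>2 \<le> (1 + \<delta>) * (t\<^sup>2 * a\<^sup>2 + c\<^sup>2 * b\<^sup>2)" for t c
    using rip Zc RZ unfolding rip_bounds_def FZ[symmetric] by blast+
  \<comment> \<open>The optimal weight: it gives \<open>t A\<close> and \<open>B\<close> the same
    Frobenius norm. Subtracting the lower bound for one sign from the upper bound for the other then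
    isolates the cross term.\<close>
  define t where "t = b / a"
  have t: "0 < t" "t\<^sup>2 * a\<^sup>2 = b\<^sup>2" using pos by (auto simp: t_def power_divide)
  have "4 * t * \<bar>v\<bar> \<le> 4 * \<delta> * b\<^sup>2"
    using bounds(1)[of t 1] bounds(2)[of t 1] bounds(1)[of t "-1"] bounds(2)[of t "-1"] t
    unfolding SZ by (cases "v \<ge> 0") (simp_all add: algebra_simps)
  then have "t * \<bar>v\<bar> \<le> t * (\<delta> * a * b)"
    using pos by (simp add: t_def power2_eq_square field_simps)
  then show ?thesis using t by (simp add: a_def b_def v_def)
qed

end

subsection \<open>The null space property\<close>

text \<open>Orthogonality of \<open>H\<^sub>1\<close> to every truncation, and not just to
  \<open>H\<^sub>2\<close>, makes \<open>Y\<close> orthogonal to each block after the leading one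
  and gives \<open>Y\<close> at least the norm of \<open>H\<^sub>1\<close>.\<close>

lemma (in measurement) low_rank_part_le:
  assumes X: "X \<in> carrier_mat n p" and kernel: "S X = 0\<^sub>v m"
    and k: "1 \<le> k" and svd: "left_svd n p H\<^sub>2 U s"
    and H1: "H\<^sub>1 \<in> carrier_mat n p" "vec_space.rank n H\<^sub>1 \<le> 2 * k" and sum: "X = H\<^sub>1 + H\<^sub>2"
    and orth: "\<And>T. mat_inner H\<^sub>1 (left_svd.trunc n H\<^sub>2 U T) = 0"
    and rip4: "rip_bounds n p S (4 * k) \<delta>\<^sub>4" and rip3: "rip_bounds n p S (3 * k) \<delta>\<^sub>3"
    and \<delta>: "0 \<le> \<delta>\<^sub>4" "\<delta>\<^sub>3 < 1"
  shows "sqrt k * frob_norm H\<^sub>1 \<le> \<delta>\<^sub>4 / (1 - \<delta>\<^sub>3) * nuclear_norm H\<^sub>2"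
proof -
  interpret left_svd n p H\<^sub>2 U s by (rule svd)
  define Y where "Y = H\<^sub>1 + trunc {..<k}"
  \<comment> \<open>The first \<open>N\<close> blocks after the leading one, gathered in a single
    truncation.\<close>
  define R where "R N = trunc {k..<k + N * k}" for N
  define b where "b j = frob_norm (trunc {Suc j * k..<Suc j * k + k})" for j
  have Y: "Y \<in> carrier_mat n p" using H1 trunc_carrier by (simp add: Y_def)
  have rankY: "vec_space.rank n Y \<le> 3 * k"
    using vec_space.rank_subadditive[OF H1(1) trunc_carrier, of "{..<k}"] rank_trunc[of "{..<k}"] H1(2)
    unfolding Y_def by simp
  have orthY: "mat_inner Y (trunc T) = 0" if "T \<inter> {..<k} = {}" for T
  proof -
    have "{..<k} \<inter> T \<inter> {..<n} = {}" using that by blast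
    then show ?thesis
      unfolding Y_def mat_inner_add_left[OF H1(1) trunc_carrier trunc_carrier] orth inner_trunc by simp
  qed
  have step: "\<bar>vec_re_inner (S Y) (S (trunc {Suc j * k..<Suc j * k + k}))\<bar> \<le> \<delta>\<^sub>4 * frob_norm Y * b j" for j
    unfolding b_def
    using rank_trunc[of "{Suc j * k..<Suc j * k + k}"] rankY
    by (intro rip_almost_orthogonal[OF rip4 Y trunc_carrier] orthY) auto
  have tail: "\<bar>vec_re_inner (S Y) (S (R N))\<bar> \<le> \<delta>\<^sub>4 * frob_norm Y * (\<Sum>j<N. b j)" for N
  proof (induction N)
    case 0
    have "R 0 = 0\<^sub>m n p"
    proof (rule frob_norm_eq_0D)
      show "R 0 \<in> carrier_mat n p" by (simp add: R_def trunc_carrier)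
      have "(frob_norm (R 0))\<^sup>2 = 0" unfolding R_def frob_norm_trunc by simp
      then show "frob_norm (R 0) = 0" by simp
    qed
    then show ?case using S_carrier[OF Y] by (simp add: S_zero vec_re_inner_def)
  next
    case (Suc N)
    have "{k..<k + Suc N * k} = {k..<k + N * k} \<union> {Suc N * k..<Suc N * k + k}" by auto
    then have "R (Suc N) = R N + trunc {Suc N * k..<Suc N * k + k}"
      unfolding R_def by (simp only:) (rule trunc_Un, auto)
    then have "vec_re_inner (S Y) (S (R (Suc N)))
        = vec_re_inner (S Y) (S (R N)) + vec_re_inner (S Y) (S (trunc {Suc N * k..<Suc N * k + k}))"
      unfolding R_def
      by (simp only: S_add[OF trunc_carrier trunc_carrier]
          vec_re_inner_add_right[OF S_carrier[OF Y] S_carrier[OF trunc_carrier] S_carrier[OF trunc_carrier]])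
    then show ?case using Suc.IH step[of N] by (simp add: distrib_left)
  qed
  \<comment> \<open>Since \<open>k\<close> is at least 1, \<open>n\<close> further blocks reach
    beyond index \<open>n\<close> and exhaust \<open>H\<^sub>2\<close>.\<close>
  have "X = Y + R n"
  proof -
    have "s i = 0" if "i \<notin> {..<k} \<union> {k..<k + n * k}" for i
    proof (rule s_ge_n)
      have "n * 1 \<le> n * k" using k by (intro mult_le_mono2)
      moreover have "k + n * k \<le> i" using that by auto
      ultimately show "n \<le> i" by linarith
    qed
    then have "H\<^sub>2 = trunc ({..<k} \<union> {k..<k + n * k})" using trunc_all by metis
    also have "\<dots> = trunc {..<k} + R n" unfolding R_def by (rule trunc_Un) auto
    finally show ?thesis
      unfolding sum Y_def R_def using H1(1) trunc_carrier assoc_add_mat by metis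
  qed
  then have "0\<^sub>v m = S Y + S (R n)" using kernel S_add[OF Y, of "R n"] trunc_carrier R_def by metis
  \<comment> \<open>The kernel condition is paired with \<open>S Y\<close>, so the squared norm of
    \<open>S Y\<close> becomes minus the cross term bounded by \<open>tail\<close>.\<close>
  then have "vec_re_inner (S Y) (S Y) + vec_re_inner (S Y) (S (R n)) = vec_re_inner (S Y) (0\<^sub>v m)"
    using vec_re_inner_add_right[OF S_carrier[OF Y] S_carrier[OF Y] S_carrier, of "R n"] trunc_carrier R_def by metis
  also have "\<dots> = 0" using S_carrier[OF Y] by (simp add: vec_re_inner_def)
  finally have SY: "(l2_norm (S Y))\<^sup>2 = - vec_re_inner (S Y) (S (R n))"
    using S_carrier[OF Y]
    by (simp add: l2_norm_sq vec_re_inner_def cmod_power2 power2_eq_square[of "Re _"] power2_eq_square[of "Im _"])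
  have "(1 - \<delta>\<^sub>3) * (frob_norm Y)\<^sup>2 \<le> (l2_norm (S Y))\<^sup>2"
    using rip3 Y rankY unfolding rip_bounds_def by blast
  also have "\<dots> \<le> \<delta>\<^sub>4 * frob_norm Y * (\<Sum>j<n. b j)" using tail[of n] unfolding SY by linarith
  finally have main: "frob_norm Y * ((1 - \<delta>\<^sub>3) * frob_norm Y) \<le> frob_norm Y * (\<delta>\<^sub>4 * (\<Sum>j<n. b j))"
    by (simp add: power2_eq_square mult_ac)
  have b0: "0 \<le> b j" for j unfolding b_def by (rule frob_norm_nonneg[OF trunc_carrier])
  \<comment> \<open>One factor \<open>frob_norm Y\<close> is cancelled; if it is zero, the
    right-hand side is nonnegative anyway.\<close>
  have "(1 - \<delta>\<^sub>3) * frob_norm Y \<le> \<delta>\<^sub>4 * (\<Sum>j<n. b j)"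
  proof (cases "frob_norm Y = 0")
    case True
    then show ?thesis using \<delta> b0 by (simp add: sum_nonneg)
  next
    case False
    then show ?thesis using main frob_norm_nonneg[OF Y] by (simp add: mult_le_cancel_left)
  qed
  moreover have "frob_norm H\<^sub>1 \<le> frob_norm Y"
  proof (rule power2_le_imp_le)
    show "(frob_norm H\<^sub>1)\<^sup>2 \<le> (frob_norm Y)\<^sup>2"
      unfolding Y_def using frob_norm_add_sq[OF H1(1) trunc_carrier] orth by simp
  qed (rule frob_norm_nonneg[OF Y])
  ultimately have "(1 - \<delta>\<^sub>3) * frob_norm H\<^sub>1 \<le> \<delta>\<^sub>4 * (\<Sum>j<n. b j)"
    using \<delta> mult_left_mono[of "frob_norm H\<^sub>1" "frob_norm Y" "1 - \<delta>\<^sub>3"] by linarith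
  then have "sqrt k * ((1 - \<delta>\<^sub>3) * frob_norm H\<^sub>1) \<le> sqrt k * (\<delta>\<^sub>4 * (\<Sum>j<n. b j))"
    by (rule mult_left_mono) simp
  also have "\<dots> = \<delta>\<^sub>4 * (sqrt k * (\<Sum>j<n. b j))" by simp
  also have "\<dots> \<le> \<delta>\<^sub>4 * nuclear_norm H\<^sub>2"
    unfolding b_def using sum_frob_norm_blocks_le[OF k] \<delta>(1) by (rule mult_left_mono)
  finally show ?thesis using \<delta>(2) by (simp add: field_simps)
qed

section \<open>The decomposition adapted to the column and row space\<close>

lemma minus_zero_right_mat: "M \<in> carrier_mat n p \<Longrightarrow> M - 0\<^sub>m n p = (M :: complex mat)"
  by (rule eq_matI) auto

lemma projection_complement:
  fixes C C' :: "complex mat"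
  assumes C: "C \<in> carrier_mat d d" "mat_adjoint C = C" "C * C = C" and C'_def: "C' = 1\<^sub>m d - C"
  shows "C' \<in> carrier_mat d d" "mat_adjoint C' = C'" "C' * C' = C'" "C * C' = 0\<^sub>m d d"
    and "M \<in> carrier_mat q d \<Longrightarrow> M * C = M \<Longrightarrow> M * C' = 0\<^sub>m q d"
    and "N \<in> carrier_mat d q \<Longrightarrow> C' * N = N - C * N"
    and "M \<in> carrier_mat q d \<Longrightarrow> M * C' = M - M * C"
proof -
  show C': "C' \<in> carrier_mat d d" unfolding C'_def by (rule minus_carrier_mat[OF C(1)])
  show "mat_adjoint C' = C'" using C by (simp add: C'_def mat_adjoint_minus[of _ d d])
  show right: "M * C' = M - M * C" if "M \<in> carrier_mat q d" for M q
    using that C by (simp add: C'_def mult_minus_distrib_mat[of _ q d _ d])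
  show left: "C' * N = N - C * N" if "N \<in> carrier_mat d q" for N q
    using that C by (simp add: C'_def minus_mult_distrib_mat[of _ d d _ _ q])
  show CC': "C * C' = 0\<^sub>m d d" using C by (simp add: right[OF C(1)])
  show "C' * C' = C'" using left[OF C'] C' by (simp add: CC' minus_zero_right_mat)
  show "M * C' = 0\<^sub>m q d" if "M \<in> carrier_mat q d" "M * C = M"
    using that by (simp add: right)
qed

text \<open>The projections \<open>P'\<close> and \<open>Q'\<close> annihilate the column and row
  space of \<open>X\<^sub>1\<close>, so both products of \<open>X\<^sub>1\<close> with
  \<open>H\<^sub>2\<close> vanish. Orthogonality is stated for all truncations because the block
  argument needs it in that strength.\<close>

lemma orthogonal_decomposition:
  fixes X X\<^sub>1 :: "complex mat"
  assumes X: "X \<in> carrier_mat n p" and X1: "X\<^sub>1 \<in> carrier_mat n p" and rank: "vec_space.rank n X\<^sub>1 \<le> k"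
  obtains H\<^sub>1 H\<^sub>2 U s where "H\<^sub>1 \<in> carrier_mat n p" "H\<^sub>2 \<in> carrier_mat n p" "X = H\<^sub>1 + H\<^sub>2"
    "vec_space.rank n H\<^sub>1 \<le> 2 * k" "X\<^sub>1 * mat_adjoint H\<^sub>2 = 0\<^sub>m n n" "mat_adjoint X\<^sub>1 * H\<^sub>2 = 0\<^sub>m p p"
    "left_svd n p H\<^sub>2 U s" "\<forall>T. mat_inner H\<^sub>1 (left_svd.trunc n H\<^sub>2 U T) = 0"
proof -
  obtain P where P: "P \<in> carrier_mat n n" "mat_adjoint P = P" "P * P = P" "P * X\<^sub>1 = X\<^sub>1"
    "vec_space.rank n P \<le> k"
    using column_space_projection[OF X1 rank] by blast
  have X1a: "mat_adjoint X\<^sub>1 \<in> carrier_mat p n" using X1 by simp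
  \<comment> \<open>\<open>Q\<close> comes from the column space of the adjoint of
    \<open>X\<^sub>1\<close>; taking adjoints later turns this into
    \<open>X\<^sub>1 * Q = X\<^sub>1\<close>.\<close>
  have "vec_space.rank p (mat_adjoint X\<^sub>1) \<le> k" using rank_adjoint_le[OF X1] rank by simp
  then obtain Q where Q: "Q \<in> carrier_mat p p" "mat_adjoint Q = Q" "Q * Q = Q"
    "Q * mat_adjoint X\<^sub>1 = mat_adjoint X\<^sub>1" "vec_space.rank p Q \<le> k"
    using column_space_projection[OF X1a] by blast
  define P' where "P' = 1\<^sub>m n - P"
  define Q' where "Q' = 1\<^sub>m p - Q"
  note P' = projection_complement[OF P(1-3) P'_def] and Q' = projection_complement[OF Q(1-3) Q'_def]
  note car = X X1 X1a P(1) Q(1) P'(1) Q'(1)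
  have PX: "P' * X \<in> carrier_mat n p" "P * X \<in> carrier_mat n p"
    "X * Q' \<in> carrier_mat n p" "P' * X * Q \<in> carrier_mat n p"
    by (rule mult_carrier_mat, use car in \<open>auto intro!: mult_carrier_mat\<close>)+
  define H2 where "H2 = P' * X * Q'"
  define H1 where "H1 = X - H2"
  have H2: "H2 \<in> carrier_mat n p" unfolding H2_def by (rule mult_carrier_mat[OF PX(1) Q'(1)])
  have H1: "H1 \<in> carrier_mat n p" unfolding H1_def by (rule minus_carrier_mat[OF H2])
  have H2a: "mat_adjoint H2 = Q' * (mat_adjoint X * P')"
    unfolding H2_def mat_adjoint_mult[OF PX(1) Q'(1)] mat_adjoint_mult[OF P'(1) X] P'(2) Q'(2) ..
  have "mat_adjoint X\<^sub>1 * P = mat_adjoint (P * X\<^sub>1)"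
    using mat_adjoint_mult[OF P(1) X1] P(2) by simp
  then have X1aP: "mat_adjoint X\<^sub>1 * P' = 0\<^sub>m p n" using P'(5)[OF X1a] P(4) by simp
  have "mat_adjoint (X\<^sub>1 * Q) = mat_adjoint X\<^sub>1"
    using mat_adjoint_mult[OF X1 Q(1)] Q(2,4) by simp
  then have "X\<^sub>1 * Q = X\<^sub>1" using mat_adjoint_adjoint by metis
  then have X1Q: "X\<^sub>1 * Q' = 0\<^sub>m n p" using Q'(5)[OF X1] by simp
  have o1: "X\<^sub>1 * mat_adjoint H2 = 0\<^sub>m n n"
  proof -
    have "X\<^sub>1 * mat_adjoint H2 = (X\<^sub>1 * Q') * (mat_adjoint X * P')"
      unfolding H2a using car by (intro assoc_mult_mat[symmetric, of _ n p _ p _ n]) (auto intro!: mult_carrier_mat)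
    then show ?thesis unfolding X1Q using car by (simp add: left_mult_zero_mat[of _ p n])
  qed
  have o2: "mat_adjoint X\<^sub>1 * H2 = 0\<^sub>m p p"
  proof -
    have "mat_adjoint X\<^sub>1 * H2 = (mat_adjoint X\<^sub>1 * P') * (X * Q')"
      unfolding H2_def using car
      by (simp add: assoc_mult_mat[of _ n n _ p _ p] assoc_mult_mat[of _ p n _ n _ p])
    then show ?thesis unfolding X1aP using PX by (simp add: left_mult_zero_mat[of _ n p])
  qed
  have PH2: "P * H2 = 0\<^sub>m n p"
  proof -
    have "P * H2 = (P * P') * (X * Q')"
      unfolding H2_def using car
      by (simp add: assoc_mult_mat[of _ n n _ p _ p] assoc_mult_mat[of _ n n _ n _ p])
    then show ?thesis unfolding P'(4) using PX by (simp add: left_mult_zero_mat[of _ n p])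
  qed
  have H2Q: "H2 * Q' = H2"
    unfolding H2_def using assoc_mult_mat[OF PX(1) Q'(1) Q'(1)] Q'(3) by simp
  have sum: "X = H1 + H2" unfolding H1_def using X H2 by (intro eq_matI) auto
  \<comment> \<open>The source of the bound \<open>2 * k\<close>: one summand factors through
    \<open>P\<close>, the other through \<open>Q\<close>, and each has rank at most
    \<open>k\<close>.\<close>
  have H1_alt: "H1 = P * X + (P' * X) * Q"
  proof -
    have "H2 = P' * X - P' * X * Q" unfolding H2_def by (rule Q'(7)[OF PX(1)])
    then have "H1 = X - (X - P * X - P' * X * Q)"
      unfolding H1_def by (simp only: P'(6)[OF X])
    also have "\<dots> = P * X + P' * X * Q"
      using PX X by (intro eq_matI) (auto simp del: index_mult_mat)
    finally show ?thesis .
  qed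
  have "vec_space.rank n H1 \<le> vec_space.rank n (P * X) + vec_space.rank n ((P' * X) * Q)"
    unfolding H1_alt by (rule vec_space.rank_subadditive[OF PX(2,4)])
  also have "vec_space.rank n (P * X) \<le> k" using rank_mult_right[OF P(1) X] P(5) by simp
  also have "vec_space.rank n ((P' * X) * Q) \<le> k"
    using rank_mult_left[OF Q(1) PX(1)] Q(5) by simp
  finally have rk: "vec_space.rank n H1 \<le> 2 * k" by simp
  obtain U s where svd: "left_svd n p H2 U s" using left_svd_exists[OF H2] .
  interpret left_svd n p H2 U s by (rule svd)
  \<comment> \<open>A truncation \<open>E\<close> inherits \<open>P * E = 0\<close> and
    \<open>E * Q' = E\<close> from \<open>H2\<close>. Hence \<open>P'\<close> and \<open>Q'\<close>
    can be moved from \<open>E\<close> onto \<open>H1\<close>, where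
    \<open>P' * H1 * Q' = H2 - H2\<close> is zero.\<close>
  have orth: "mat_inner H1 (trunc T) = 0" for T
  proof -
    define E where "E = trunc T"
    have E: "E \<in> carrier_mat n p" by (simp add: E_def trunc_carrier)
    have "P * E = 0\<^sub>m n p" unfolding E_def by (rule mult_trunc_eq_0[OF P(1) PH2])
    then have P'E: "P' * E = E" using P'(6)[OF E] E by (simp add: minus_zero_right_mat)
    have EQ': "E * Q' = E" unfolding E_def by (rule trunc_mult_right[OF Q'(1) H2Q])
    have "P' * H2 = H2" using P'(6)[OF H2] H2 PH2 by (simp add: minus_zero_right_mat)
    then have "P' * H1 = P' * X - H2"
      unfolding H1_def using mult_minus_distrib_mat[OF P'(1) X H2] by simp
    then have "P' * H1 * Q' = H2 - H2"
      using minus_mult_distrib_mat[OF PX(1) H2 Q'(1)] H2Q by (simp add: H2_def)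
    then have "mat_inner (P' * H1 * Q') E = 0"
      using H2 E by (simp add: mat_inner_sum[of _ n p])
    moreover have "mat_inner (P' * H1 * Q') E = mat_inner H1 E"
      using mat_inner_mult_right[OF mult_carrier_mat[OF P'(1) H1] Q'(1) E]
        mat_inner_mult_left[OF P'(1) H1 E] P'(2) Q'(2) EQ' P'E by simp
    ultimately show ?thesis by (simp add: E_def)
  qed
  show thesis by (rule that[OF H1 H2 sum rk o1 o2 svd allI[OF orth]])
qed

theorem proposition6p8:
  fixes n p m k :: nat and \<S> :: "complex mat \<Rightarrow> complex vec" and \<eta> :: real
  assumes "n \<le> p" and "1 \<le> k" and "4 * k \<le> n"
    and "mat_vec_linear n p m \<S>"
    and "0 < rip_const n p \<S> (4 * k)" and "rip_const n p \<S> (4 * k) < sqrt 2 - 1"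
  defines "\<eta> \<equiv> sqrt 2 * (rip_const n p \<S> (4 * k) / (1 - rip_const n p \<S> (3 * k)))"
  shows "0 < \<eta> \<and> \<eta> < 1 \<and> strong_rank_nsp n p m \<S> k \<eta>"
proof -
  interpret measurement n p m \<S> by (rule measurement.intro[OF assms(4)])
  define \<delta>\<^sub>4 where "\<delta>\<^sub>4 = rip_const n p \<S> (4 * k)"
  define \<delta>\<^sub>3 where "\<delta>\<^sub>3 = rip_const n p \<S> (3 * k)"
  have np: "1 \<le> n" "1 \<le> p" using assms(1-3) by linarith+
  have rip: "rip_bounds n p \<S> (4 * k) \<delta>\<^sub>4" "rip_bounds n p \<S> (3 * k) \<delta>\<^sub>3"
    unfolding \<delta>\<^sub>4_def \<delta>\<^sub>3_def by (rule rip_const_least(1)[OF np], use assms(2) in linarith)+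
  have le: "\<delta>\<^sub>3 \<le> \<delta>\<^sub>4"
    unfolding \<delta>\<^sub>4_def \<delta>\<^sub>3_def by (rule rip_const_mono[OF np]) (use assms(2) in linarith)+
  have \<delta>\<^sub>4: "0 < \<delta>\<^sub>4" "\<delta>\<^sub>4 < sqrt 2 - 1" using assms(5,6) by (simp_all only: \<delta>\<^sub>4_def)
  have "sqrt 2 < 2" by (rule real_less_lsqrt) auto
  then have lt1: "\<delta>\<^sub>3 < 1" using le \<delta>\<^sub>4 by linarith
  have \<eta>: "\<eta> = sqrt 2 * (\<delta>\<^sub>4 / (1 - \<delta>\<^sub>3))" unfolding \<eta>_def \<delta>\<^sub>4_def \<delta>\<^sub>3_def ..
  have pos: "0 < \<eta>" unfolding \<eta> using \<delta>\<^sub>4 lt1 by simp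
  have "(sqrt 2 + 1) * \<delta>\<^sub>4 < (sqrt 2 + 1) * (sqrt 2 - 1)"
    using \<delta>\<^sub>4(2) by (rule mult_strict_left_mono) (simp add: add_pos_pos)
  also have "\<dots> = 1" by (simp add: algebra_simps)
  finally have "sqrt 2 * \<delta>\<^sub>4 < 1 - \<delta>\<^sub>3" using le by (simp add: algebra_simps)
  then have less1: "\<eta> < 1" unfolding \<eta> using lt1 by (simp add: field_simps)
  have "strong_rank_nsp n p m \<S> k \<eta>"
    unfolding strong_rank_nsp_def
  proof (intro conjI ballI impI pos less1)
    fix X X\<^sub>1 X\<^sub>2 assume X: "X \<in> carrier_mat n p" and X1: "X\<^sub>1 \<in> carrier_mat n p"
      and *: "\<S> X = 0\<^sub>v m \<and> X \<noteq> 0\<^sub>m n p \<and> X = X\<^sub>1 + X\<^sub>2 \<and> vec_space.rank n X\<^sub>1 \<le> k"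
    then have ker: "\<S> X = 0\<^sub>v m" and rk: "vec_space.rank n X\<^sub>1 \<le> k" by blast+
    obtain H\<^sub>1 H\<^sub>2 U s where H: "H\<^sub>1 \<in> carrier_mat n p" "H\<^sub>2 \<in> carrier_mat n p" "X = H\<^sub>1 + H\<^sub>2"
      "vec_space.rank n H\<^sub>1 \<le> 2 * k" "X\<^sub>1 * mat_adjoint H\<^sub>2 = 0\<^sub>m n n" "mat_adjoint X\<^sub>1 * H\<^sub>2 = 0\<^sub>m p p"
      and svd: "left_svd n p H\<^sub>2 U s" and orth: "\<forall>T. mat_inner H\<^sub>1 (left_svd.trunc n H\<^sub>2 U T) = 0"
      using orthogonal_decomposition[OF X X1 rk] .
    obtain U' s' where svd1: "left_svd n p H\<^sub>1 U' s'" using left_svd_exists[OF H(1)] .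
    \<comment> \<open>The rank bound \<open>2 * k\<close> yields the factor \<open>sqrt 2\<close> of
      \<eta>; the remaining \<open>sqrt k\<close> is absorbed by
      \<open>low_rank_part_le\<close>.\<close>
    have "nuclear_norm H\<^sub>1 \<le> sqrt (2 * k) * frob_norm H\<^sub>1"
      using left_svd.nuclear_norm_le[OF svd1 H(4)] by simp
    also have "\<dots> = sqrt 2 * (sqrt k * frob_norm H\<^sub>1)" by (simp add: real_sqrt_mult)
    also have "\<dots> \<le> sqrt 2 * (\<delta>\<^sub>4 / (1 - \<delta>\<^sub>3) * nuclear_norm H\<^sub>2)"
      using low_rank_part_le[OF X ker assms(2) svd H(1,4,3) orth[rule_format] rip less_imp_le[OF \<delta>\<^sub>4(1)] lt1]
      by (rule mult_left_mono) simp
    finally have nuc: "nuclear_norm H\<^sub>1 \<le> \<eta> * nuclear_norm H\<^sub>2" by (simp add: \<eta>)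
    \<comment> \<open>The truncation to all indices is \<open>H\<^sub>2\<close> itself.\<close>
    have inner: "mat_inner H\<^sub>1 H\<^sub>2 = 0"
      using orth[rule_format, of UNIV] left_svd.trunc_all[OF svd, of UNIV] by simp
    show "\<exists>H\<^sub>1\<in>carrier_mat n p. \<exists>H\<^sub>2\<in>carrier_mat n p.
        X = H\<^sub>1 + H\<^sub>2 \<and> vec_space.rank n H\<^sub>1 \<le> 2 * k \<and> mat_inner H\<^sub>1 H\<^sub>2 = 0 \<and>
        X\<^sub>1 * mat_adjoint H\<^sub>2 = 0\<^sub>m n n \<and> mat_adjoint X\<^sub>1 * H\<^sub>2 = 0\<^sub>m p p \<and>
        nuclear_norm H\<^sub>1 \<le> \<eta> * nuclear_norm H\<^sub>2"
    proof (rule bexI[OF _ H(1)], rule bexI[OF _ H(2)])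
      show "X = H\<^sub>1 + H\<^sub>2 \<and> vec_space.rank n H\<^sub>1 \<le> 2 * k \<and> mat_inner H\<^sub>1 H\<^sub>2 = 0 \<and>
        X\<^sub>1 * mat_adjoint H\<^sub>2 = 0\<^sub>m n n \<and> mat_adjoint X\<^sub>1 * H\<^sub>2 = 0\<^sub>m p p \<and>
        nuclear_norm H\<^sub>1 \<le> \<eta> * nuclear_norm H\<^sub>2"
        by (rule conjI[OF H(3) conjI[OF H(4) conjI[OF inner conjI[OF H(5) conjI[OF H(6) nuc]]]]])
    qed
  qed
  with pos less1 show ?thesis by blast
qed

end
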